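(* Let $k$ be a field, let $G$ be a finite simple graph without isolated vertices, with nonempty vertex set $V(G)=\{x_1,\dots,x_n\}$ and with $p$ connected components, let $R=k[x_1,\dots,x_n]$, and let $I=I(G)\subseteq R$ be the edge ideal of $G$. Then for every integer $t\geq 1$, $$\operatorname{depth} R/I^t\ \geq\ p-t .$$
   Context: Simple graph: no loops and no multiple edges. Vertices of $G$ are identified with the variables of $R$. The edge ideal $I(G)$ is the ideal of $R$ generated by the monomials $x_ix_j$ with $\{x_i,x_j\}\in E(G)$. $\operatorname{depth} R/I^t$ is the maximum length of an $R/I^t$-regular sequence in $\mathfrak m=(x_1,\dots,x_n)$. *)

theory Defs
  imports
    "HOL-Algebra.Algebraic_Closure_Type"
    "HOL-Algebra.Ideal_Product"
    "HOL-Algebra.QuotRing"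
    "HOL-Algebra.Module"
    "HOL-Library.Poly_Mapping"
    "HOL-Library.Extended_Nat"
begin

section \<open>Graphs\<close>

text \<open>The vertex set is the whole type \<open>'v\<close>, which the theorem assumes to be finite; types are
  nonempty, so a graph has at least one vertex.\<close>

definition simple_graph :: "'v set set \<Rightarrow> bool" where
  "simple_graph E \<longleftrightarrow> (\<forall>e\<in>E. card e = 2)"

definition no_isolated_vertices :: "'v set set \<Rightarrow> bool" where
  "no_isolated_vertices E \<longleftrightarrow> (\<forall>v. \<exists>e\<in>E. v \<in> e)"

definition connected_components :: "'v set set \<Rightarrow> 'v set set" where
  "connected_components E = UNIV // {(u, v). {u, v} \<in> E}\<^sup>*"


section \<open>Regular sequences and depth\<close>

text \<open>\<open>R/J\<close> as an \<open>R\<close>-module.  The module record also has the fields \<open>mult\<close> and \<open>one\<close>, on which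
  the module structure does not depend.\<close>

definition quot_module :: "('a, 'm) ring_scheme \<Rightarrow> 'a set \<Rightarrow> ('a, 'a set) module" where
  "quot_module R J =
    \<lparr>carrier = carrier (R Quot J),
     monoid.mult = (\<otimes>\<^bsub>R Quot J\<^esub>), one = \<one>\<^bsub>R Quot J\<^esub>,
     ring.zero = \<zero>\<^bsub>R Quot J\<^esub>, add = (\<oplus>\<^bsub>R Quot J\<^esub>),
     module.smult = (\<lambda>r x. (J +>\<^bsub>R\<^esub> r) \<otimes>\<^bsub>R Quot J\<^esub> x)\<rparr>"

lemma (in ideal) quot_module_is_module:
  assumes "cring R"
  shows "module R (quot_module R I)"
proof -
  interpret Q: ring "R Quot I" by (rule quotient_is_ring)
  interpret h: ring_hom_ring R "R Quot I" "(+>) I" by (rule rcos_ring_hom_ring)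
  have ag: "abelian_group (quot_module R I)"
  proof (rule abelian_groupI)
    fix x assume "x \<in> carrier (quot_module R I)"
    then show "\<exists>y\<in>carrier (quot_module R I).
        y \<oplus>\<^bsub>quot_module R I\<^esub> x = \<zero>\<^bsub>quot_module R I\<^esub>"
      by (intro bexI[of _ "\<ominus>\<^bsub>R Quot I\<^esub> x"]) (simp_all add: quot_module_def Q.l_neg)
  qed (simp_all add: quot_module_def Q.a_ac)
  show ?thesis
    by (rule moduleI[OF assms ag])
       (simp_all add: quot_module_def Q.l_distr Q.r_distr Q.m_assoc)
qed

text \<open>The submodule \<open>FM\<close> of \<open>M\<close>, generated by all \<open>f\<cdot>x\<close> with \<open>f \<in> F\<close> and \<open>x \<in> M\<close>; it equals
  \<open>(F)M\<close> for the ideal \<open>(F)\<close> of \<open>R\<close> generated by \<open>F\<close>, and it is the zero submodule if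
  \<open>F = {}\<close>.\<close>

definition set_smult :: "('a, 'm) ring_scheme \<Rightarrow> ('a, 'b, 'n) module_scheme \<Rightarrow> 'a set \<Rightarrow> 'b set" where
  "set_smult R M F =
    \<Inter> {N. submodule N R M \<and> (\<forall>f\<in>F. \<forall>x\<in>carrier M. f \<odot>\<^bsub>M\<^esub> x \<in> N)}"

text \<open>Each \<open>f\<^sub>i\<close> is a nonzerodivisor on \<open>M/(f\<^sub>1,\<dots>,f\<^sub>i\<^sub>-\<^sub>1)M\<close>, and
  \<open>(f\<^sub>1,\<dots>,f\<^sub>d)M \<noteq> M\<close>.\<close>

definition regular_sequence ::
    "('a, 'm) ring_scheme \<Rightarrow> ('a, 'b, 'n) module_scheme \<Rightarrow> 'a list \<Rightarrow> bool" where
  "regular_sequence R M fs \<longleftrightarrow>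
    set fs \<subseteq> carrier R \<and>
    (\<forall>i<length fs. \<forall>x\<in>carrier M.
       fs ! i \<odot>\<^bsub>M\<^esub> x \<in> set_smult R M (set (take i fs)) \<longrightarrow>
       x \<in> set_smult R M (set (take i fs))) \<and>
    set_smult R M (set fs) \<noteq> carrier M"

text \<open>The supremum in \<open>enat\<close> is the maximum whenever the lengths are bounded, as they are for a
  finitely generated module over a polynomial ring in finitely many variables.\<close>

definition depth ::
    "('a, 'm) ring_scheme \<Rightarrow> 'a set \<Rightarrow> ('a, 'b, 'n) module_scheme \<Rightarrow> enat" where
  "depth R \<mm> M =
    (SUP fs \<in> {fs. regular_sequence R M fs \<and> set fs \<subseteq> \<mm>}. enat (length fs))"


section \<open>Edge ideals\<close>

text \<open>Polynomials in the variables \<open>'v\<close> over \<open>'k\<close>: finitely supported coefficient functions on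
  exponent vectors.\<close>

type_synonym ('v, 'k) mpoly = "('v \<Rightarrow>\<^sub>0 nat) \<Rightarrow>\<^sub>0 'k"

abbreviation mpoly_ring :: "('v, 'k::field) mpoly ring" where
  "mpoly_ring \<equiv> ring_of_type_algebra"

definition indet :: "'v \<Rightarrow> ('v, 'k::field) mpoly" where
  "indet v = Poly_Mapping.single (Poly_Mapping.single v 1) 1"

definition max_ideal :: "('v, 'k::field) mpoly set" where
  "max_ideal = Idl\<^bsub>mpoly_ring\<^esub> (range indet)"

definition edge_ideal :: "'v set set \<Rightarrow> ('v, 'k::field) mpoly set" where
  "edge_ideal E = Idl\<^bsub>mpoly_ring\<^esub> {indet u * indet v | u v. {u, v} \<in> E}"

text \<open>\<open>ideals_set R\<close> is the monoid of ideals under the ideal product, with unit \<open>R\<close>.\<close>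

definition ideal_power :: "('a, 'm) ring_scheme \<Rightarrow> 'a set \<Rightarrow> nat \<Rightarrow> 'a set" where
  "ideal_power R I t = I [^]\<^bsub>ideals_set R\<^esub> t"

end

theory Submission
  imports Defs "HOL-Library.Set_Algebras" "HOL-Library.Nat_Bijection"
begin

text \<open>For a component \<open>C\<close> let \<open>y\<^sub>C\<close> be the sum of its vertices, and let \<open>d = p - t\<close>.  The
  elementary symmetric polynomials \<open>e\<^sub>d, \<dots>, e\<^sub>1\<close> in the \<open>y\<^sub>C\<close>, in this order, form a regular sequence
  on \<open>R/I\<^sup>t\<close> over every field.  The monomials outside \<open>I\<^sup>t\<close> are a basis of \<open>R/I\<^sup>t\<close>, and the support of
  such a monomial is independent in all but fewer than \<open>t\<close> components.  Filtering by the
  support and then by the degree in all but \<open>d\<close> chosen vertices, one from each of \<open>d\<close> such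
  components, yields graded pieces on which the \<open>y\<^sub>C\<close> of these components act as multiplication by the
  chosen vertex and all other \<open>y\<^sub>C\<close> act as zero.  So \<open>e\<^sub>d\<close> acts as a product of \<open>d\<close> variables that
  are regular in any order, and filtering modulo this product by its partial products reduces \<open>d\<close> by one.\<close>

section \<open>Weakly regular sequences and filtrations\<close>

text \<open>The components in which a support is independent vary from one monomial to another,
  while one sequence must serve all graded pieces; this is why its terms are symmetric in the y_C.
  Linear forms in the y_C whose coefficient matrix has only nonzero maximal minors would also do,
  but over a small field such a matrix need not exist. The number t enters in one place: edges taken
  from t different components are disjoint, so a monomial divisible by all of them lies in I^t.
  Fixing the support does not suffice to make y_C act as one variable, since the other vertices of
  the support still act nontrivially. Filtering by the degree in the vertices that were not chosen
  turns these actions into zero, at the price of an infinite chain. The passage to its limit is what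
  requires graded ideals and homogeneous parameters.\<close>

definition is_ideal :: "'a::comm_ring_1 set \<Rightarrow> bool" where
  "is_ideal I \<longleftrightarrow> 0 \<in> I \<and> (\<forall>x\<in>I. \<forall>y\<in>I. x + y \<in> I) \<and> (\<forall>r. \<forall>x\<in>I. r * x \<in> I)"

lemma is_idealI:
  assumes "0 \<in> I" "\<And>x y. x \<in> I \<Longrightarrow> y \<in> I \<Longrightarrow> x + y \<in> I" "\<And>r x. x \<in> I \<Longrightarrow> r * x \<in> I"
  shows "is_ideal I"
  using assms by (auto simp: is_ideal_def)

lemma is_ideal_zero: "is_ideal I \<Longrightarrow> 0 \<in> I"
  and is_ideal_add: "is_ideal I \<Longrightarrow> x \<in> I \<Longrightarrow> y \<in> I \<Longrightarrow> x + y \<in> I"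
  and is_ideal_mult: "is_ideal I \<Longrightarrow> x \<in> I \<Longrightarrow> r * x \<in> I"
  by (auto simp: is_ideal_def)

lemma is_ideal_uminus: "is_ideal I \<Longrightarrow> x \<in> I \<Longrightarrow> - x \<in> I"
  using is_ideal_mult[of I x "-1"] by simp

lemma is_ideal_diff: "is_ideal I \<Longrightarrow> x \<in> I \<Longrightarrow> y \<in> I \<Longrightarrow> x - y \<in> I"
  using is_ideal_add[of I x "-y"] is_ideal_uminus[of I y] by simp

lemma is_ideal_sum: "is_ideal I \<Longrightarrow> (\<And>a. a \<in> A \<Longrightarrow> f a \<in> I) \<Longrightarrow> sum f A \<in> I"
  by (induction A rule: infinite_finite_induct) (auto simp: is_ideal_zero is_ideal_add)

lemma is_ideal_UNIV: "is_ideal UNIV"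
  by (simp add: is_ideal_def)

lemma mem_plus_times_iff: "x \<in> V + \<theta> *o U \<longleftrightarrow> (\<exists>v\<in>V. \<exists>u\<in>U. x = v + \<theta> * u)"
  by (auto simp: set_plus_def elt_set_times_def)

lemma is_ideal_plus:
  assumes "is_ideal A" "is_ideal B"
  shows "is_ideal (A + B)"
proof (rule is_idealI)
  show "0 \<in> A + B"
    using set_plus_intro[OF is_ideal_zero[OF assms(1)] is_ideal_zero[OF assms(2)]] by simp
  show "x + y \<in> A + B" if xy: "x \<in> A + B" "y \<in> A + B" for x y
  proof -
    from xy obtain a b a' b' where *: "x = a + b" "y = a' + b'" "a \<in> A" "b \<in> B" "a' \<in> A" "b' \<in> B"
      by (auto elim!: set_plus_elim)
    then have "(a + a') + (b + b') \<in> A + B" using assms by (intro set_plus_intro is_ideal_add)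
    then show ?thesis by (simp add: * ac_simps)
  qed
  show "r * x \<in> A + B" if "x \<in> A + B" for r x
    using that assms by (auto elim!: set_plus_elim simp: distrib_left is_ideal_mult set_plus_intro)
qed

lemma is_ideal_times:
  assumes "is_ideal U"
  shows "is_ideal (\<theta> *o U)"
proof (rule is_idealI)
  show "0 \<in> \<theta> *o U"
    using set_times_intro2[OF is_ideal_zero[OF assms], of \<theta>] by simp
  show "x + y \<in> \<theta> *o U" if xy: "x \<in> \<theta> *o U" "y \<in> \<theta> *o U" for x y
  proof -
    from xy obtain u v where "x = \<theta> * u" "y = \<theta> * v" "u \<in> U" "v \<in> U"
      by (auto simp: elt_set_times_def)
    then show ?thesis
      using set_times_intro2[OF is_ideal_add[OF assms, of u v], of \<theta>] by (simp add: distrib_left)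
  qed
  show "r * x \<in> \<theta> *o U" if x: "x \<in> \<theta> *o U" for r x
  proof -
    from x obtain u where "x = \<theta> * u" "u \<in> U" by (auto simp: elt_set_times_def)
    then show ?thesis
      using set_times_intro2[OF is_ideal_mult[OF assms, of u r], of \<theta>] by (simp add: mult.left_commute)
  qed
qed

lemma is_ideal_plus_times: "is_ideal V \<Longrightarrow> is_ideal U \<Longrightarrow> is_ideal (V + \<theta> *o U)"
  by (simp add: is_ideal_plus is_ideal_times)

lemma plus_times_subset:
  assumes "is_ideal U" "V \<subseteq> U"
  shows "V + \<theta> *o U \<subseteq> U"
  using assms by (force simp: mem_plus_times_iff is_ideal_add is_ideal_mult)

lemma subset_plus_ideal: "is_ideal B \<Longrightarrow> A \<subseteq> A + B"
  by (metis add.commute is_ideal_zero set_zero_plus2)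

lemma plus_ideal_absorb: "is_ideal U \<Longrightarrow> V \<subseteq> U \<Longrightarrow> is_ideal V \<Longrightarrow> U + V = U"
  by (intro subset_antisym subset_plus_ideal) (auto elim!: set_plus_elim intro: is_ideal_add)

lemma plus_times_absorb: "is_ideal V \<Longrightarrow> V + \<theta> *o V = V"
  by (intro subset_antisym plus_times_subset subset_plus_ideal is_ideal_times) auto

section \<open>Regular elements and weakly regular sequences on U/V\<close>

definition regular_on :: "'a::comm_ring_1 \<Rightarrow> 'a set \<Rightarrow> 'a set \<Rightarrow> bool" where
  "regular_on \<theta> U V \<longleftrightarrow> (\<forall>x\<in>U. \<theta> * x \<in> V \<longrightarrow> x \<in> V)"

text \<open>No condition \<open>(\<theta>\<^sub>1, \<dots>, \<theta>\<^sub>r)U + V \<noteq> U\<close> is imposed, so that the notion passes through filtrations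
  with trivial graded pieces.\<close>

fun weakly_regular :: "'a::comm_ring_1 list \<Rightarrow> 'a set \<Rightarrow> 'a set \<Rightarrow> bool" where
  "weakly_regular [] U V = True"
| "weakly_regular (\<theta> # \<theta>s) U V = (regular_on \<theta> U V \<and> weakly_regular \<theta>s U (V + \<theta> *o U))"

lemma regular_onD: "regular_on \<theta> U V \<Longrightarrow> x \<in> U \<Longrightarrow> \<theta> * x \<in> V \<Longrightarrow> x \<in> V"
  by (simp add: regular_on_def)

lemma weakly_regular_refl: "is_ideal U \<Longrightarrow> weakly_regular \<theta>s U U"
proof (induction \<theta>s)
  case (Cons \<theta> \<theta>s)
  then show ?case by (simp add: regular_on_def plus_times_absorb)
qed simp

text \<open>The isomorphism of A/(A \<inter> B) with (A + B)/B respects multiplication. Dividing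
  both sides by \<theta> preserves this shape, with B + \<theta>A in place of B, so the induction
  goes through.\<close>

lemma weakly_regular_second_iso:
  assumes "is_ideal A" "is_ideal B" "weakly_regular \<theta>s A (A \<inter> B)"
  shows "weakly_regular \<theta>s (A + B) B"
  using assms(2,3)
proof (induction \<theta>s arbitrary: B)
  case (Cons \<theta> \<theta>s)
  have reg: "regular_on \<theta> (A + B) B"
    unfolding regular_on_def
  proof (intro ballI impI)
    fix x assume "x \<in> A + B" and x: "\<theta> * x \<in> B"
    from this(1) obtain a b where ab: "x = a + b" "a \<in> A" "b \<in> B" by (rule set_plus_elim)
    have "\<theta> * x - \<theta> * b \<in> B"
      using ab x Cons.prems(1) by (simp add: is_ideal_diff is_ideal_mult)
    also have "\<theta> * x - \<theta> * b = \<theta> * a" using ab by (simp add: algebra_simps)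
    finally have "\<theta> * a \<in> A \<inter> B"
      using ab assms(1) by (simp add: is_ideal_mult)
    then show "x \<in> B"
      using Cons.prems ab by (auto dest: regular_onD intro: is_ideal_add)
  qed
  define B' where "B' = B + \<theta> *o A"
  have B': "is_ideal B'" unfolding B'_def by (simp add: is_ideal_plus_times Cons.prems assms(1))
  \<comment> \<open>The modular law, as \<theta>A lies in A.\<close>
  have "A \<inter> B' = A \<inter> B + \<theta> *o A"
  proof
    show "A \<inter> B' \<subseteq> A \<inter> B + \<theta> *o A"
    proof
      fix x assume "x \<in> A \<inter> B'"
      then obtain b a where ab: "x = b + \<theta> * a" "b \<in> B" "a \<in> A" "x \<in> A"
        by (auto simp: B'_def mem_plus_times_iff)
      have "x - \<theta> * a \<in> A" using ab(3,4) assms(1) by (intro is_ideal_diff is_ideal_mult)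
      then have "b \<in> A" using ab by simp
      with ab show "x \<in> A \<inter> B + \<theta> *o A" by (auto simp: mem_plus_times_iff)
    qed
    show "A \<inter> B + \<theta> *o A \<subseteq> A \<inter> B'"
      using assms(1) by (auto simp: B'_def set_plus_def elt_set_times_def is_ideal_add is_ideal_mult)
  qed
  then have "weakly_regular \<theta>s (A + B') B'"
    using Cons.IH[OF B'] Cons.prems by simp
  moreover have "A + B' = A + B"
  proof -
    have "A + B' = (A + \<theta> *o A) + B" by (simp add: B'_def ac_simps)
    then show ?thesis using assms(1) by (simp add: plus_times_absorb)
  qed
  moreover have "B' = B + \<theta> *o (A + B)"
  proof -
    have "B + \<theta> *o (A + B) = (B + \<theta> *o B) + \<theta> *o A"
      by (simp add: set_times_plus_distrib2 ac_simps)
    then show ?thesis using Cons.prems(1) by (simp add: B'_def plus_times_absorb)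
  qed
  ultimately show ?case using reg by simp
qed simp

text \<open>U/W is an extension of U/V by V/W, and the point is that dividing by \<theta> yields an
  extension of the same kind: its submodule (V + \<theta>U)/(W + \<theta>U) is V/(W + \<theta>V) up
  to isomorphism.\<close>

lemma weakly_regular_trans:
  assumes "is_ideal U" "is_ideal V" "is_ideal W" "W \<subseteq> V" "V \<subseteq> U"
    and "weakly_regular \<theta>s U V" "weakly_regular \<theta>s V W"
  shows "weakly_regular \<theta>s U W"
  using assms(2-)
proof (induction \<theta>s arbitrary: V W)
  case (Cons \<theta> \<theta>s)
  have reg: "regular_on \<theta> U W"
    unfolding regular_on_def
  proof (intro ballI impI)
    fix x assume "x \<in> U" "\<theta> * x \<in> W"
    then show "x \<in> W" using Cons.prems
      by (metis regular_onD subsetD weakly_regular.simps(2))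
  qed
  define W' where "W' = W + \<theta> *o U"
  have W': "is_ideal W'" by (simp add: W'_def is_ideal_plus_times Cons.prems assms(1))
  \<comment> \<open>Regularity of \<theta> on U/V enters here: \<theta>u in V forces u in V.\<close>
  have "V \<inter> W' = W + \<theta> *o V"
  proof
    show "V \<inter> W' \<subseteq> W + \<theta> *o V"
    proof
      fix x assume "x \<in> V \<inter> W'"
      then obtain w u where wu: "x = w + \<theta> * u" "w \<in> W" "u \<in> U" "x \<in> V"
        by (auto simp: W'_def mem_plus_times_iff)
      have "\<theta> * u = x - w" using wu by simp
      then have "\<theta> * u \<in> V" using is_ideal_diff[of V x w] wu Cons.prems by auto
      then have "u \<in> V" using wu Cons.prems by (auto dest: regular_onD)
      with wu show "x \<in> W + \<theta> *o V" by (auto simp: mem_plus_times_iff)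
    qed
    show "W + \<theta> *o V \<subseteq> V \<inter> W'"
    proof -
      have "W + \<theta> *o V \<subseteq> W'"
        unfolding W'_def using Cons.prems(4) by (intro set_plus_mono2 set_times_mono) auto
      then show ?thesis using Cons.prems plus_times_subset[of V W \<theta>] by auto
    qed
  qed
  then have "weakly_regular \<theta>s (V + W') W'"
    using weakly_regular_second_iso[OF Cons.prems(1) W'] Cons.prems by simp
  moreover have "V + W' = V + \<theta> *o U"
    using plus_ideal_absorb[OF Cons.prems(1,3,2)] by (simp add: W'_def flip: add.assoc)
  ultimately have 1: "weakly_regular \<theta>s (V + \<theta> *o U) W'" by simp
  have "weakly_regular \<theta>s U W'"
  proof (rule Cons.IH[OF _ W' _ _ _ 1])
    show "is_ideal (V + \<theta> *o U)" by (simp add: is_ideal_plus_times Cons.prems assms(1))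
    show "W' \<subseteq> V + \<theta> *o U" unfolding W'_def using Cons.prems(3) by (intro set_plus_mono2) auto
    show "V + \<theta> *o U \<subseteq> U" using Cons.prems assms(1) by (intro plus_times_subset)
    show "weakly_regular \<theta>s U (V + \<theta> *o U)" using Cons.prems by simp
  qed
  then show ?case using reg by (simp add: W'_def)
qed simp

text \<open>Multiplication by \<open>a\<close> induces an isomorphism from \<open>U/P\<close> onto \<open>(V + aU)/(V + aP)\<close>.\<close>

lemma weakly_regular_mult_iso:
  assumes "is_ideal U" "is_ideal V" "regular_on a U V" "is_ideal P" "V \<subseteq> P" "P \<subseteq> U"
    and "weakly_regular \<theta>s U P"
  shows "weakly_regular \<theta>s (V + a *o U) (V + a *o P)"
  using assms(4-)
proof (induction \<theta>s arbitrary: P)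
  case (Cons \<theta> \<theta>s)
  have reg: "regular_on \<theta> (V + a *o U) (V + a *o P)"
    unfolding regular_on_def
  proof (intro ballI impI)
    fix x assume "x \<in> V + a *o U" "\<theta> * x \<in> V + a *o P"
    then obtain v u v' p where *: "x = v + a * u" "\<theta> * x = v' + a * p" "v \<in> V" "u \<in> U" "v' \<in> V" "p \<in> P"
      by (auto simp: mem_plus_times_iff)
    then have "a * (\<theta> * u - p) = v' - \<theta> * v" by (simp add: algebra_simps)
    also have "\<dots> \<in> V" using * assms(2) by (simp add: is_ideal_diff is_ideal_mult)
    finally have "a * (\<theta> * u - p) \<in> V" .
    moreover have "\<theta> * u - p \<in> U"
      using * assms(1) Cons.prems(3) by (intro is_ideal_diff is_ideal_mult) auto
    ultimately have "\<theta> * u - p \<in> V" using regular_onD[OF assms(3)] by blast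
    then have "\<theta> * u - p + p \<in> P" using Cons.prems * by (intro is_ideal_add) auto
    then have "u \<in> P" using * Cons.prems by (auto dest: regular_onD)
    with * show "x \<in> V + a *o P" by (auto simp: mem_plus_times_iff)
  qed
  have "V + a *o P + \<theta> *o (V + a *o U) = (V + \<theta> *o V) + (a *o P + (\<theta> * a) *o U)"
    by (simp only: set_times_plus_distrib2 set_times_rearrange2 ac_simps)
  then have "V + a *o P + \<theta> *o (V + a *o U) = V + a *o (P + \<theta> *o U)"
    using assms(2)
    by (simp add: plus_times_absorb set_times_plus_distrib2 set_times_rearrange2 mult.commute)
  moreover have "weakly_regular \<theta>s (V + a *o U) (V + a *o (P + \<theta> *o U))"
  proof (rule Cons.IH)
    show "V \<subseteq> P + \<theta> *o U" using Cons.prems subset_plus_ideal[of "\<theta> *o U" P] assms(1)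
      by (auto simp: is_ideal_times)
  qed (use Cons.prems assms(1) in \<open>simp_all add: is_ideal_plus_times plus_times_subset\<close>)
  ultimately show ?case using reg by simp
qed simp

lemma regular_on_prod:
  assumes "is_ideal U" "\<And>i. i \<in> Z \<Longrightarrow> regular_on (y i) U V"
  shows "regular_on (prod y Z) U V"
  using assms
proof (induction Z rule: infinite_finite_induct)
  case (insert i Z)
  have "x \<in> V" if x: "x \<in> U" "y i * (prod y Z * x) \<in> V" for x
  proof -
    have "prod y Z * x \<in> V"
      using regular_onD[of "y i" U V "prod y Z * x"] insert.prems x by (simp add: is_ideal_mult)
    then show ?thesis using insert x(1) by (auto dest: regular_onD)
  qed
  then show ?case using insert.hyps by (simp add: regular_on_def mult.assoc)
qed (simp_all add: regular_on_def)

text \<open>If a is the product over Z, then a is regular, so the step from V + aU down to V + a y_i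
  U is a copy of U/(V + y_i U). The steps are glued by \<open>weakly_regular_trans\<close>.\<close>

lemma weakly_regular_prod:
  assumes "is_ideal U" "is_ideal V" "V \<subseteq> U" "finite Z"
    and "\<And>i. i \<in> Z \<Longrightarrow> regular_on (y i) U V"
    and "\<And>i. i \<in> Z \<Longrightarrow> weakly_regular \<theta>s U (V + y i *o U)"
  shows "weakly_regular \<theta>s U (V + prod y Z *o U)"
  using assms(4,5,6)
proof (induction Z rule: finite_induct)
  case empty
  then show ?case
    using assms(1-3) by (simp add: weakly_regular_refl plus_ideal_absorb add.commute)
next
  case (insert i Z)
  define a where "a = prod y Z"
  have a: "regular_on a U V"
    unfolding a_def using insert.prems assms(1) by (intro regular_on_prod) auto
  have "weakly_regular \<theta>s (V + a *o U) (V + a *o (V + y i *o U))"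
    using assms(1-3) insert.prems a
    by (intro weakly_regular_mult_iso)
      (simp_all add: is_ideal_plus_times plus_times_subset is_ideal_times subset_plus_ideal)
  moreover have "V + a *o (V + y i *o U) = (V + a *o V) + (y i * a) *o U"
    by (simp only: set_times_plus_distrib2 set_times_rearrange2 ac_simps)
  then have "V + a *o (V + y i *o U) = V + prod y (insert i Z) *o U"
    using insert.hyps assms(2) by (simp add: a_def plus_times_absorb)
  ultimately have "weakly_regular \<theta>s (V + a *o U) (V + prod y (insert i Z) *o U)" by simp
  moreover have "weakly_regular \<theta>s U (V + a *o U)"
    unfolding a_def using insert by simp
  moreover have "V + prod y (insert i Z) *o U \<subseteq> V + a *o U"
  proof -
    have "prod y (insert i Z) * u = a * (y i * u)" for u using insert.hyps by (simp add: a_def ac_simps)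
    then show ?thesis using is_ideal_mult[OF assms(1)] unfolding subset_iff mem_plus_times_iff by metis
  qed
  ultimately show ?case
    by - (rule weakly_regular_trans[of U "V + a *o U"], use assms(1-3) in \<open>simp_all add: is_ideal_plus_times plus_times_subset\<close>)
qed

section \<open>Elementary symmetric polynomials\<close>

definition esym :: "('c \<Rightarrow> 'a::comm_ring_1) \<Rightarrow> 'c set \<Rightarrow> nat \<Rightarrow> 'a" where
  "esym y C d = (\<Sum>A | A \<subseteq> C \<and> card A = d. prod y A)"

lemma regular_on_cong:
  assumes "is_ideal V" "\<And>x. x \<in> U \<Longrightarrow> a * x - b * x \<in> V"
  shows "regular_on a U V \<longleftrightarrow> regular_on b U V"
proof -
  have "a * x \<in> V \<longleftrightarrow> b * x \<in> V" if "x \<in> U" for x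
    using is_ideal_diff[OF assms(1) _ assms(2)[OF that], of "a * x"]
      is_ideal_add[OF assms(1) _ assms(2)[OF that], of "b * x"] by auto
  then show ?thesis by (auto simp: regular_on_def)
qed

lemma plus_times_cong:
  assumes "is_ideal V" "\<And>x. x \<in> U \<Longrightarrow> a * x - b * x \<in> V"
  shows "V + a *o U = V + b *o U"
proof -
  have "v + a * x = (v + (a * x - b * x)) + b * x" "v + b * x = (v - (a * x - b * x)) + a * x" for v x
    by simp_all
  then show ?thesis
    unfolding set_eq_iff mem_plus_times_iff using assms is_ideal_add is_ideal_diff by metis
qed

text \<open>Every other subset of C of the same size contains an index outside Z, and its factor
  sends U into V.\<close>

lemma esym_minus_prod:
  assumes "is_ideal V" "finite C" "Z \<subseteq> C"
    and "\<And>i x. i \<in> C - Z \<Longrightarrow> x \<in> U \<Longrightarrow> y i * x \<in> V" "x \<in> U"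
  shows "esym y C (card Z) * x - prod y Z * x \<in> V"
proof -
  let ?A = "{A. A \<subseteq> C \<and> card A = card Z}"
  have fin: "finite ?A" using assms(2) by simp
  have "esym y C (card Z) = prod y Z + (\<Sum>A\<in>?A - {Z}. prod y A)"
    unfolding esym_def using assms(3) fin by (subst sum.remove[of _ Z]) auto
  then have "esym y C (card Z) * x - prod y Z * x = (\<Sum>A\<in>?A - {Z}. prod y A * x)"
    by (simp add: algebra_simps sum_distrib_left)
  also have "\<dots> \<in> V"
  proof (rule is_ideal_sum[OF assms(1)])
    fix A assume A: "A \<in> ?A - {Z}"
    have "finite A" using A assms(2) finite_subset by auto
    moreover have "finite Z" using assms(2,3) finite_subset by auto
    ultimately obtain i where i: "i \<in> A" "i \<notin> Z"
      using A card_subset_eq[of Z A] by auto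
    have "prod y A * x = prod y (A - {i}) * (y i * x)"
      using i \<open>finite A\<close> by (simp add: prod.remove[of A i] ac_simps)
    then show "prod y A * x \<in> V"
      using assms(4)[of i x] assms(5) A i is_ideal_mult[OF assms(1)] by auto
  qed
  finally show ?thesis .
qed

text \<open>On \<open>U/V\<close> the top symmetric function acts as the product of the \<open>y i\<close> with \<open>i \<in> Z\<close>, and
  modulo each single factor of this product one is back in the situation of the lemma with one index less.\<close>

lemma weakly_regular_esym:
  assumes "is_ideal U" "is_ideal V" "V \<subseteq> U" "finite C" "Z \<subseteq> C"
    and "\<And>i x. i \<in> C - Z \<Longrightarrow> x \<in> U \<Longrightarrow> y i * x \<in> V"
    and "\<And>S i. S \<subseteq> Z \<Longrightarrow> i \<in> Z - S \<Longrightarrow> regular_on (y i) U (V + (\<Sum>s\<in>S. y s *o U))"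
  shows "weakly_regular (map (esym y C) (rev [1..<Suc (card Z)])) U V"
  using assms(2,3,5,6,7)
proof (induction "card Z" arbitrary: Z V)
  case 0
  then show ?case by simp
next
  case (Suc d)
  let ?\<theta>s = "map (esym y C) (rev [1..<Suc d])"
  have "finite Z" using Suc.prems(3) assms(4) finite_subset by blast
  have diff: "esym y C (card Z) * x - prod y Z * x \<in> V" if "x \<in> U" for x
    using esym_minus_prod[OF Suc.prems(1) assms(4) Suc.prems(3)] Suc.prems(4) that by blast
  have reg: "regular_on (y i) U V" if "i \<in> Z" for i
    using Suc.prems(5)[of "{}" i] that by simp
  \<comment> \<open>Enlarging V by y_j U makes j one of the indices that act as zero. So C and the
    symmetric functions stay the same while Z loses j.\<close>
  have "weakly_regular ?\<theta>s U (V + y j *o U)" if "j \<in> Z" for j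
  proof -
    have card: "d = card (Z - {j})" using Suc.hyps(2) that \<open>finite Z\<close> by simp
    have "weakly_regular (map (esym y C) (rev [1..<Suc (card (Z - {j}))])) U (V + y j *o U)"
    proof (rule Suc.hyps(1)[OF card])
      show "is_ideal (V + y j *o U)" using Suc.prems assms(1) by (simp add: is_ideal_plus_times)
      show "V + y j *o U \<subseteq> U" using Suc.prems assms(1) by (simp add: plus_times_subset)
      show "y i * x \<in> V + y j *o U" if "i \<in> C - (Z - {j})" "x \<in> U" for i x
      proof (cases "i = j")
        case True
        then show ?thesis using that Suc.prems(1) is_ideal_zero by (force simp: mem_plus_times_iff)
      next
        case False
        then have "y i * x \<in> V" using that Suc.prems(4) by auto
        then show ?thesis using subset_plus_ideal[of "y j *o U" V] assms(1) is_ideal_times by auto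
      qed
      \<comment> \<open>This is why regularity is assumed modulo every subset of the factors: j now
        joins S.\<close>
      show "regular_on (y i) U (V + y j *o U + (\<Sum>s\<in>S. y s *o U))"
        if "S \<subseteq> Z - {j}" "i \<in> Z - {j} - S" for S i
        using Suc.prems(5)[of "insert j S" i] that \<open>j \<in> Z\<close> finite_subset[OF _ \<open>finite Z\<close>, of S]
        by (simp add: add.assoc subset_Diff_insert)
    qed (use Suc.prems in auto)
    then show ?thesis using card by simp
  qed
  then have "weakly_regular ?\<theta>s U (V + prod y Z *o U)"
    by (intro weakly_regular_prod) (use Suc.prems assms(1) reg \<open>finite Z\<close> in auto)
  moreover have "V + esym y C (card Z) *o U = V + prod y Z *o U"
    using diff by (intro plus_times_cong[OF Suc.prems(1)])
  moreover have "regular_on (esym y C (card Z)) U V"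
    using regular_on_cong[OF Suc.prems(1) diff] regular_on_prod[of U Z y V] reg assms(1) by blast
  ultimately show ?case using Suc.hyps(2)[symmetric] by simp
qed

section \<open>Monomial ideals\<close>

abbreviation var_exp :: "'v \<Rightarrow> 'v \<Rightarrow>\<^sub>0 nat" where
  "var_exp v \<equiv> Poly_Mapping.single v (Suc 0)"

lemma indet_eq: "indet v = Poly_Mapping.single (var_exp v) 1"
  by (simp add: indet_def)

definition up_closed :: "('v \<Rightarrow>\<^sub>0 nat) set \<Rightarrow> bool" where
  "up_closed S \<longleftrightarrow> (\<forall>\<alpha>\<in>S. \<forall>\<beta>. \<alpha> + \<beta> \<in> S)"

text \<open>A linear subspace for every S, and a monomial ideal if S is up-closed. Membership is a
  condition on exponents only, so sums and monomial multiples become unions and translates of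
  exponent sets.\<close>

definition monomial_span :: "('v \<Rightarrow>\<^sub>0 nat) set \<Rightarrow> ('v, 'k::field) mpoly set" where
  "monomial_span S = {x. Poly_Mapping.keys x \<subseteq> S}"

definition total_degree :: "('v::finite \<Rightarrow>\<^sub>0 nat) \<Rightarrow> nat" where
  "total_degree \<alpha> = (\<Sum>v\<in>UNIV. Poly_Mapping.lookup \<alpha> v)"

lemma total_degree_add: "total_degree (\<alpha> + \<beta>) = total_degree \<alpha> + total_degree \<beta>"
  by (simp add: total_degree_def lookup_add sum.distrib)

lemma total_degree_var_exp: "total_degree (var_exp v) = 1"
  by (simp add: total_degree_def lookup_single when_def sum.delta)

lemma exponent_split:
  assumes "v \<in> Poly_Mapping.keys (\<alpha> :: 'v \<Rightarrow>\<^sub>0 nat)"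
  shows "\<alpha> - var_exp v + var_exp v = \<alpha>"
  using assms by (intro poly_mapping_eqI) (auto simp: lookup_add lookup_minus lookup_single when_def in_keys_iff)

lemma keys_add_exp:
  "Poly_Mapping.keys (\<alpha> + \<beta>) = Poly_Mapping.keys \<alpha> \<union> Poly_Mapping.keys (\<beta> :: 'v \<Rightarrow>\<^sub>0 nat)"
  by (auto simp: in_keys_iff lookup_add)

text \<open>Every exponent is a sum of exponents of single variables, so induction on its degree
  reduces to one variable.\<close>

lemma up_closedI:
  fixes S :: "('v::finite \<Rightarrow>\<^sub>0 nat) set"
  assumes "\<And>\<alpha> v. \<alpha> \<in> S \<Longrightarrow> \<alpha> + var_exp v \<in> S"
  shows "up_closed S"
proof -
  have "\<alpha> + \<beta> \<in> S" if "\<alpha> \<in> S" for \<alpha> \<beta>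
    using that
  proof (induction "total_degree \<beta>" arbitrary: \<beta> \<alpha>)
    case 0
    then have "\<beta> = 0" by (intro poly_mapping_eqI) (simp add: total_degree_def)
    with 0 show ?case by simp
  next
    case (Suc n)
    then obtain v where "v \<in> Poly_Mapping.keys \<beta>"
      by (metis in_keys_iff nat.distinct(1) sum.neutral total_degree_def)
    then have \<beta>: "\<beta> - var_exp v + var_exp v = \<beta>" by (rule exponent_split)
    have "total_degree (\<beta> - var_exp v + var_exp v) = Suc n" using Suc \<beta> by simp
    then have "n = total_degree (\<beta> - var_exp v)" by (simp only: total_degree_add total_degree_var_exp)
    from Suc.hyps(1)[OF this Suc.prems] have "\<alpha> + (\<beta> - var_exp v) + var_exp v \<in> S" by (rule assms)
    then show ?case by (simp add: add.assoc \<beta>)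
  qed
  then show ?thesis by (simp add: up_closed_def)
qed

lemma monomial_span_mono: "S \<subseteq> T \<Longrightarrow> monomial_span S \<subseteq> monomial_span T"
  by (auto simp: monomial_span_def)

lemma is_ideal_monomial_span:
  assumes "up_closed S"
  shows "is_ideal (monomial_span S :: ('v, 'k::field) mpoly set)"
proof (rule is_idealI)
  show "0 \<in> monomial_span S" by (simp add: monomial_span_def)
  show "x + y \<in> monomial_span S" if "x \<in> monomial_span S" "y \<in> monomial_span S" for x y :: "('v, 'k) mpoly"
    using that keys_add[of x y] by (auto simp: monomial_span_def)
  show "r * x \<in> monomial_span S" if "x \<in> monomial_span S" for r x :: "('v, 'k) mpoly"
    using that keys_mult[of r x] assms by (fastforce simp: monomial_span_def up_closed_def add.commute)
qed

lemma lookup_single_mult: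
  fixes x :: "('v \<Rightarrow>\<^sub>0 nat) \<Rightarrow>\<^sub>0 'k::field"
  shows "Poly_Mapping.lookup (Poly_Mapping.single \<alpha> 1 * x) (\<alpha> + \<beta>) = Poly_Mapping.lookup x \<beta>"
  by (simp add: lookup_mult lookup_single when_mult)

lemma keys_single_mult:
  fixes x :: "('v \<Rightarrow>\<^sub>0 nat) \<Rightarrow>\<^sub>0 'k::field"
  shows "Poly_Mapping.keys (Poly_Mapping.single \<alpha> 1 * x) = (+) \<alpha> ` Poly_Mapping.keys x"
proof
  show "Poly_Mapping.keys (Poly_Mapping.single \<alpha> 1 * x) \<subseteq> (+) \<alpha> ` Poly_Mapping.keys x"
    using keys_mult[of "Poly_Mapping.single \<alpha> 1" x] by auto
qed (auto simp: in_keys_iff lookup_single_mult)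

lemma single_times_monomial_span:
  "Poly_Mapping.single \<alpha> 1 *o monomial_span S = (monomial_span ((+) \<alpha> ` S) :: ('v, 'k::field) mpoly set)"
proof
  show "Poly_Mapping.single \<alpha> 1 *o monomial_span S \<subseteq> (monomial_span ((+) \<alpha> ` S) :: ('v, 'k) mpoly set)"
    by (auto simp: elt_set_times_def monomial_span_def keys_single_mult intro!: imageI)
  show "monomial_span ((+) \<alpha> ` S) \<subseteq> Poly_Mapping.single \<alpha> 1 *o (monomial_span S :: ('v, 'k) mpoly set)"
  proof
    fix x :: "('v, 'k) mpoly" assume x: "x \<in> monomial_span ((+) \<alpha> ` S)"
    \<comment> \<open>The quotient of x by the monomial of exponent \<alpha>.\<close>
    define u where "u = Poly_Mapping.map_key ((+) \<alpha>) x"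
    have lu: "Poly_Mapping.lookup u \<beta> = Poly_Mapping.lookup x (\<alpha> + \<beta>)" for \<beta>
      by (simp add: u_def map_key.rep_eq)
    have ku: "Poly_Mapping.keys u \<subseteq> S"
    proof
      fix \<beta> assume "\<beta> \<in> Poly_Mapping.keys u"
      then have "\<alpha> + \<beta> \<in> Poly_Mapping.keys x" by (simp add: in_keys_iff lu)
      then have "\<alpha> + \<beta> \<in> (+) \<alpha> ` S" using x by (auto simp: monomial_span_def)
      then show "\<beta> \<in> S" by auto
    qed
    have "x = Poly_Mapping.single \<alpha> 1 * u"
    proof (rule poly_mapping_eqI)
      fix k
      show "Poly_Mapping.lookup x k = Poly_Mapping.lookup (Poly_Mapping.single \<alpha> 1 * u) k"
      proof (cases "k \<in> range ((+) \<alpha>)")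
        case True
        then show ?thesis by (auto simp: lookup_single_mult lu)
      next
        case False
        then have "k \<notin> Poly_Mapping.keys x" using x by (auto simp: monomial_span_def)
        moreover have "k \<notin> Poly_Mapping.keys (Poly_Mapping.single \<alpha> 1 * u)"
          using False by (auto simp: keys_single_mult)
        ultimately show ?thesis by (simp add: in_keys_iff)
      qed
    qed
    then show "x \<in> Poly_Mapping.single \<alpha> 1 *o monomial_span S"
      using ku by (auto simp: elt_set_times_def monomial_span_def)
  qed
qed

section \<open>Truncation of polynomials and graded subsets\<close>

definition restrict_keys :: "('a \<Rightarrow> bool) \<Rightarrow> ('a \<Rightarrow>\<^sub>0 'b::zero) \<Rightarrow> 'a \<Rightarrow>\<^sub>0 'b" where
  "restrict_keys P x = Poly_Mapping.mapp (\<lambda>k c. c when P k) x"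

lemma lookup_restrict_keys: "Poly_Mapping.lookup (restrict_keys P x) k = (Poly_Mapping.lookup x k when P k)"
  by (auto simp: restrict_keys_def lookup_mapp when_def in_keys_iff)

lemma keys_restrict_keys: "Poly_Mapping.keys (restrict_keys P x) = {k \<in> Poly_Mapping.keys x. P k}"
  by (auto simp: in_keys_iff lookup_restrict_keys when_def split: if_splits)

lemma restrict_keys_split:
  fixes x :: "'a \<Rightarrow>\<^sub>0 'b::monoid_add"
  shows "restrict_keys P x + restrict_keys (\<lambda>k. \<not> P k) x = x"
  by (intro poly_mapping_eqI) (simp add: lookup_add lookup_restrict_keys when_def)

lemma restrict_keys_add:
  fixes x :: "'a \<Rightarrow>\<^sub>0 'b::monoid_add"
  shows "restrict_keys P (x + y) = restrict_keys P x + restrict_keys P y"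
  by (intro poly_mapping_eqI) (simp add: lookup_add lookup_restrict_keys when_def)

lemma restrict_keys_id: "(\<And>k. k \<in> Poly_Mapping.keys x \<Longrightarrow> P k) \<Longrightarrow> restrict_keys P x = x"
  by (intro poly_mapping_eqI) (auto simp: lookup_restrict_keys when_def in_keys_iff split: if_splits)

lemma restrict_keys_eq_0: "(\<And>k. k \<in> Poly_Mapping.keys x \<Longrightarrow> \<not> P k) \<Longrightarrow> restrict_keys P x = 0"
  by (intro poly_mapping_eqI) (auto simp: lookup_restrict_keys when_def in_keys_iff)

lemma monomial_span_plus: "monomial_span S + monomial_span T = (monomial_span (S \<union> T) :: ('v, 'k::field) mpoly set)"
proof
  show "monomial_span S + monomial_span T \<subseteq> (monomial_span (S \<union> T) :: ('v, 'k) mpoly set)"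
    using keys_add by (fastforce simp: monomial_span_def elim!: set_plus_elim)
  show "monomial_span (S \<union> T) \<subseteq> (monomial_span S + monomial_span T :: ('v, 'k) mpoly set)"
  proof
    fix x :: "('v, 'k) mpoly" assume "x \<in> monomial_span (S \<union> T)"
    then have "restrict_keys (\<lambda>k. k \<in> S) x \<in> monomial_span S" "restrict_keys (\<lambda>k. k \<notin> S) x \<in> monomial_span T"
      by (auto simp: monomial_span_def keys_restrict_keys)
    then show "x \<in> monomial_span S + monomial_span T"
      using set_plus_intro restrict_keys_split[of "\<lambda>k. k \<in> S" x] by metis
  qed
qed

text \<open>For subspaces this agrees with the usual notion, since a homogeneous component is the
  difference of two successive truncations. Truncation is additive and suits the comparison with
  tails of high degree.\<close>

definition graded :: "('v::finite, 'k::field) mpoly set \<Rightarrow> bool" where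
  "graded V \<longleftrightarrow> (\<forall>x\<in>V. \<forall>n. restrict_keys (\<lambda>\<alpha>. total_degree \<alpha> < n) x \<in> V)"

definition homogeneous :: "nat \<Rightarrow> ('v::finite, 'k::field) mpoly \<Rightarrow> bool" where
  "homogeneous e \<theta> \<longleftrightarrow> (\<forall>\<alpha>\<in>Poly_Mapping.keys \<theta>. total_degree \<alpha> = e)"

lemma graded_monomial_span: "graded (monomial_span S)"
  by (auto simp: graded_def monomial_span_def keys_restrict_keys)

text \<open>Multiplication by \<theta> raises degrees by exactly e. For n \<le> e the subtraction
  yields 0, and both sides vanish.\<close>

lemma restrict_keys_homogeneous_mult:
  assumes "homogeneous e \<theta>"
  shows "restrict_keys (\<lambda>\<alpha>. total_degree \<alpha> < n) (\<theta> * u) =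
    \<theta> * restrict_keys (\<lambda>\<alpha>. total_degree \<alpha> < n - e) u"
proof -
  define a b where "a = restrict_keys (\<lambda>\<alpha>. total_degree \<alpha> < n - e) u"
    and "b = restrict_keys (\<lambda>\<alpha>. \<not> total_degree \<alpha> < n - e) u"
  have "\<theta> * u = \<theta> * a + \<theta> * b"
    by (simp only: a_def b_def restrict_keys_split flip: distrib_left)
  moreover have "restrict_keys (\<lambda>\<alpha>. total_degree \<alpha> < n) (\<theta> * a) = \<theta> * a"
    using keys_mult[of \<theta> a] assms
    by (intro restrict_keys_id) (fastforce simp: homogeneous_def a_def keys_restrict_keys total_degree_add)
  moreover have "restrict_keys (\<lambda>\<alpha>. total_degree \<alpha> < n) (\<theta> * b) = 0"
    using keys_mult[of \<theta> b] assms
    by (intro restrict_keys_eq_0) (fastforce simp: homogeneous_def b_def keys_restrict_keys total_degree_add)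
  ultimately show ?thesis by (simp add: restrict_keys_add a_def)
qed

lemma graded_plus_times:
  assumes "graded V" "graded U" "homogeneous e \<theta>"
  shows "graded (V + \<theta> *o U)"
  unfolding graded_def
proof (intro ballI allI)
  fix x n assume "x \<in> V + \<theta> *o U"
  then obtain v u where "x = v + \<theta> * u" "v \<in> V" "u \<in> U" by (auto simp: mem_plus_times_iff)
  then show "restrict_keys (\<lambda>\<alpha>. total_degree \<alpha> < n) x \<in> V + \<theta> *o U"
    using assms(1,2) unfolding graded_def
    by (auto simp: restrict_keys_add restrict_keys_homogeneous_mult[OF assms(3)])
qed

lemma graded_mem_limit:
  assumes "graded V" "\<And>n. x \<in> V + monomial_span {\<alpha>. n \<le> total_degree \<alpha>}"
  shows "x \<in> V"
proof -
  \<comment> \<open>This n exceeds all degrees in x, so truncation below n fixes x and kills the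
    tail d.\<close>
  define n where "n = Suc (\<Sum>\<alpha>\<in>Poly_Mapping.keys x. total_degree \<alpha>)"
  obtain v d where vd: "x = v + d" "v \<in> V" "d \<in> monomial_span {\<alpha>. n \<le> total_degree \<alpha>}"
    using assms(2)[of n] by (rule set_plus_elim)
  have "x = restrict_keys (\<lambda>\<alpha>. total_degree \<alpha> < n) x"
    by (rule restrict_keys_id[symmetric]) (simp add: n_def le_imp_less_Suc member_le_sum)
  also have "\<dots> = restrict_keys (\<lambda>\<alpha>. total_degree \<alpha> < n) v + restrict_keys (\<lambda>\<alpha>. total_degree \<alpha> < n) d"
    by (simp add: vd restrict_keys_add)
  also have "restrict_keys (\<lambda>\<alpha>. total_degree \<alpha> < n) d = 0"
    using vd(3) by (intro restrict_keys_eq_0) (auto simp: monomial_span_def)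
  finally show ?thesis using assms(1) vd(2) by (metis graded_def add.right_neutral)
qed

text \<open>Gradedness makes \<open>V + (\<theta>\<^sub>1, \<dots>, \<theta>\<^sub>i)U\<close> the intersection of the \<open>F n + (\<theta>\<^sub>1, \<dots>, \<theta>\<^sub>i)U\<close>, as in each
  degree these agree for large \<open>n\<close>.\<close>

lemma weakly_regular_limit:
  assumes "graded U" "graded V" "\<And>n. V \<subseteq> F n"
    and "\<And>n. F n \<subseteq> V + monomial_span {\<alpha>. n \<le> total_degree \<alpha>}"
    and "\<And>\<theta>. \<theta> \<in> set \<theta>s \<Longrightarrow> \<exists>e. homogeneous e \<theta>"
    and "\<And>n. weakly_regular \<theta>s U (F n)"
  shows "weakly_regular \<theta>s U V"
  using assms(2-)
proof (induction \<theta>s arbitrary: V F)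
  case (Cons \<theta> \<theta>s)
  have "regular_on \<theta> U V"
    unfolding regular_on_def
  proof (intro ballI impI)
    fix x assume x: "x \<in> U" "\<theta> * x \<in> V"
    show "x \<in> V"
    proof (rule graded_mem_limit[OF Cons.prems(1)])
      fix n
      have "x \<in> F n" using Cons.prems(2,5)[of n] x by (auto dest: regular_onD)
      then show "x \<in> V + monomial_span {\<alpha>. n \<le> total_degree \<alpha>}" using Cons.prems(3) by blast
    qed
  qed
  moreover have "weakly_regular \<theta>s U (V + \<theta> *o U)"
  proof (rule Cons.IH[where F = "\<lambda>n. F n + \<theta> *o U"])
    show "graded (V + \<theta> *o U)"
      using Cons.prems(1,4) assms(1) graded_plus_times by (metis list.set_intros(1))
    show "V + \<theta> *o U \<subseteq> F n + \<theta> *o U" for n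
      using Cons.prems(2) by (intro set_plus_mono2) auto
    show "F n + \<theta> *o U \<subseteq> V + \<theta> *o U + monomial_span {\<alpha>. n \<le> total_degree \<alpha>}" for n
      using set_plus_mono2[OF Cons.prems(3)[of n] order_refl, of "\<theta> *o U"] by (simp add: ac_simps)
  qed (use Cons.prems in auto)
  ultimately show ?case by simp
qed simp

lemma homogeneous_mult: "homogeneous d x \<Longrightarrow> homogeneous e y \<Longrightarrow> homogeneous (d + e) (x * y)"
  using keys_mult[of x y] by (fastforce simp: homogeneous_def total_degree_add)

lemma homogeneous_sum: "(\<And>i. i \<in> A \<Longrightarrow> homogeneous e (g i)) \<Longrightarrow> homogeneous e (sum g A)"
proof (induction A rule: infinite_finite_induct)
  case (insert i A)
  then show ?case using keys_add[of "g i" "sum g A"] by (auto simp: homogeneous_def)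
qed (auto simp: homogeneous_def)

lemma homogeneous_prod: "(\<And>i. i \<in> A \<Longrightarrow> homogeneous 1 (g i)) \<Longrightarrow> homogeneous (card A) (prod g A)"
proof (induction A rule: infinite_finite_induct)
  case (insert i A)
  then show ?case using homogeneous_mult[of 1 "g i" "card A" "prod g A"] by simp
qed (auto simp: homogeneous_def total_degree_def lookup_one)

lemma homogeneous_indet: "homogeneous 1 (indet v)"
  by (simp add: homogeneous_def indet_eq total_degree_var_exp)

lemma homogeneous_esym:
  assumes "\<And>i. i \<in> C \<Longrightarrow> homogeneous 1 (y i)"
  shows "homogeneous d (esym y C d)"
  unfolding esym_def using assms by (intro homogeneous_sum) (auto intro!: homogeneous_prod)

text \<open>Translates \<open>weakly_regular_esym\<close> into exponents. The monomials with
  exponents in K outside T form a basis of U/V. By \<open>zero\<close> and \<open>shift\<close>, y_i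
  acts on it as an injective translation by \<open>h i\<close> if i is in Z and as zero otherwise.
  By \<open>cross\<close>, a monomial that becomes a multiple of the variable \<open>h j\<close>
  after multiplication by \<open>h i\<close> was one before, so these variables are regular modulo
  one another in any order.\<close>

lemma weakly_regular_monomial_span:
  fixes A :: "'c \<Rightarrow> 'v::finite set" and h :: "'c \<Rightarrow> 'v"
  defines "y \<equiv> \<lambda>i. \<Sum>v\<in>A i. (indet v :: ('v, 'k::field) mpoly)"
  assumes up: "up_closed T" "up_closed (K \<union> T)"
    and C: "finite C" "Z \<subseteq> C" "\<And>i. i \<in> Z \<Longrightarrow> h i \<in> A i"
    and zero: "\<And>\<alpha> i v. \<alpha> \<in> K \<Longrightarrow> i \<in> C \<Longrightarrow> v \<in> A i \<Longrightarrow> (i \<in> Z \<Longrightarrow> v \<noteq> h i) \<Longrightarrow> \<alpha> + var_exp v \<in> T"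
    and shift: "\<And>\<alpha> i. \<alpha> \<in> K \<Longrightarrow> i \<in> Z \<Longrightarrow> \<alpha> + var_exp (h i) \<notin> T"
    and cross: "\<And>\<alpha> \<gamma> i j. \<alpha> \<in> K \<Longrightarrow> \<gamma> \<in> K \<Longrightarrow> i \<in> Z \<Longrightarrow> j \<in> Z \<Longrightarrow> i \<noteq> j \<Longrightarrow>
      \<alpha> + var_exp (h i) = \<gamma> + var_exp (h j) \<Longrightarrow> \<exists>\<gamma>'\<in>K \<union> T. \<alpha> = \<gamma>' + var_exp (h j)"
  shows "weakly_regular (map (esym y C) (rev [1..<Suc (card Z)])) (monomial_span (K \<union> T)) (monomial_span T)"
proof -
  define S where "S = K \<union> T"
  note span_ideals = is_ideal_monomial_span[OF up(1)] is_ideal_monomial_span[OF up(2), folded S_def]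
  have TI: "indet v * x \<in> monomial_span T"
    if "x \<in> monomial_span S" "i \<in> C" "v \<in> A i" "i \<in> Z \<Longrightarrow> v \<noteq> h i" for v i and x :: "('v, 'k) mpoly"
  proof -
    have "\<alpha> + var_exp v \<in> T" if "\<alpha> \<in> Poly_Mapping.keys x" for \<alpha>
      using that \<open>x \<in> monomial_span S\<close> zero[OF _ \<open>i \<in> C\<close> \<open>v \<in> A i\<close>] \<open>i \<in> Z \<Longrightarrow> v \<noteq> h i\<close> up(1)
      by (auto simp: monomial_span_def S_def up_closed_def)
    then show ?thesis
      by (auto simp: monomial_span_def indet_eq keys_single_mult add.commute)
  qed
  have out: "y i * x \<in> monomial_span T" if "i \<in> C - Z" "x \<in> monomial_span S" for i x
    unfolding y_def sum_distrib_right
    by (rule is_ideal_sum[OF span_ideals(1)]) (use that TI in auto)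
  have lead: "y i * x - indet (h i) * x \<in> monomial_span T" if "i \<in> Z" "x \<in> monomial_span S" for i x
  proof -
    have "y i = indet (h i) + (\<Sum>v\<in>A i - {h i}. indet v)"
      unfolding y_def using C(3)[OF that(1)] by (intro sum.remove) auto
    then have "y i * x - indet (h i) * x = (\<Sum>v\<in>A i - {h i}. indet v * x)"
      by (simp add: algebra_simps sum_distrib_left)
    also have "\<dots> \<in> monomial_span T"
      by (rule is_ideal_sum[OF span_ideals(1)]) (use that TI C(2) in auto)
    finally show ?thesis .
  qed
  \<comment> \<open>The exponents of V plus all y_i U with i in B. This ideal is monomial because
    y_i agrees modulo V with the single variable \<open>h i\<close>.\<close>
  define Q where "Q = (\<lambda>B. T \<union> (\<Union>i\<in>B. (+) (var_exp (h i)) ` S))"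
  have upQ: "up_closed (Q B)" for B
    using up unfolding Q_def up_closed_def S_def by (fastforce simp: add.assoc)
  have quot: "monomial_span T + (\<Sum>i\<in>B. y i *o monomial_span S) = monomial_span (Q B)" if "B \<subseteq> Z" for B
  proof -
    have "finite B" using that C(1,2) by (meson finite_subset)
    then show ?thesis using that
    proof (induction B rule: finite_induct)
      case empty
      then show ?case by (simp add: Q_def)
    next
      case (insert i B)
      have "monomial_span T + (\<Sum>j\<in>insert i B. y j *o monomial_span S) = (monomial_span T + (\<Sum>j\<in>B. y j *o monomial_span S)) + y i *o monomial_span S"
        using insert.hyps by (simp add: add.assoc add.commute[of "y i *o monomial_span S"])
      also have "\<dots> = monomial_span (Q B) + y i *o monomial_span S"
        using insert by simp
      also have "\<dots> = monomial_span (Q B) + indet (h i) *o monomial_span S"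
      proof (rule plus_times_cong[OF is_ideal_monomial_span[OF upQ]])
        fix x :: "('v, 'k) mpoly" assume "x \<in> monomial_span S"
        with insert have "y i * x - indet (h i) * x \<in> monomial_span T" by (intro lead) auto
        then show "y i * x - indet (h i) * x \<in> monomial_span (Q B)" by (auto simp: monomial_span_def Q_def)
      qed
      also have "\<dots> = monomial_span (Q (insert i B))"
        unfolding indet_eq single_times_monomial_span monomial_span_plus by (simp add: Q_def Un_ac)
      finally show ?case .
    qed
  qed
  show ?thesis
    unfolding S_def[symmetric]
  proof (rule weakly_regular_esym[OF span_ideals(2,1) _ C(1,2) out])
    show "monomial_span T \<subseteq> (monomial_span S :: ('v, 'k) mpoly set)" by (auto simp: monomial_span_def S_def)
    fix B i assume B: "B \<subseteq> Z" "i \<in> Z - B"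
    have "x \<in> monomial_span (Q B)" if x: "x \<in> monomial_span S" "indet (h i) * x \<in> monomial_span (Q B)" for x :: "('v, 'k) mpoly"
      unfolding monomial_span_def
    proof (intro CollectI subsetI)
      fix \<alpha> assume \<alpha>: "\<alpha> \<in> Poly_Mapping.keys x"
      show "\<alpha> \<in> Q B"
      proof (cases "\<alpha> \<in> T")
        case False
        then have "\<alpha> \<in> K" using x(1) \<alpha> by (auto simp: monomial_span_def S_def)
        have "\<alpha> + var_exp (h i) \<in> Q B"
          using x(2) \<alpha> by (auto simp: monomial_span_def indet_eq keys_single_mult add.commute)
        then obtain j \<gamma> where j: "j \<in> B" "\<gamma> \<in> S" "\<alpha> + var_exp (h i) = \<gamma> + var_exp (h j)"
          using shift[OF \<open>\<alpha> \<in> K\<close>, of i] B by (auto simp: Q_def add.commute)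
        \<comment> \<open>If \<gamma> were in T, then so would be its translate by
          \<open>h j\<close>, against \<open>shift\<close> for \<alpha>.\<close>
        have "\<gamma> \<in> K"
          using j shift[OF \<open>\<alpha> \<in> K\<close>, of i] B up(1) by (auto simp: S_def up_closed_def)
        then obtain \<gamma>' where "\<gamma>' \<in> S" "\<alpha> = \<gamma>' + var_exp (h j)"
          using cross[OF \<open>\<alpha> \<in> K\<close> _ _ _ _ j(3)] j B by (auto simp: S_def)
        then show ?thesis using j by (auto simp: Q_def add.commute)
      qed (simp add: Q_def)
    qed
    then have "regular_on (indet (h i)) (monomial_span S) (monomial_span (Q B) :: ('v, 'k) mpoly set)"
      by (simp add: regular_on_def)
    moreover have "y i * x - indet (h i) * x \<in> monomial_span (Q B)" if "x \<in> monomial_span S" for x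
      using lead[OF _ that, of i] B by (auto simp: monomial_span_def Q_def)
    ultimately have "regular_on (y i) (monomial_span S) (monomial_span (Q B))"
      using regular_on_cong[OF is_ideal_monomial_span[OF upQ]] by blast
    then show "regular_on (y i) (monomial_span S) (monomial_span T + (\<Sum>s\<in>B. y s *o monomial_span S))"
      using quot B by simp
  qed
qed

section \<open>The filtration of a power of an edge ideal\<close>

text \<open>The exponents divisible by a product of t edges, with repetition allowed;
  \<open>ideal_power_edge_ideal\<close> shows that they are those of the monomials in I^t.\<close>

fun edge_exponents :: "'v set set \<Rightarrow> nat \<Rightarrow> ('v \<Rightarrow>\<^sub>0 nat) set" where
  "edge_exponents E 0 = UNIV"
| "edge_exponents E (Suc t) =
    {\<gamma> + var_exp u + var_exp v | \<gamma> u v. \<gamma> \<in> edge_exponents E t \<and> {u, v} \<in> E}"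

lemma up_closed_edge_exponents: "up_closed (edge_exponents E t)"
proof (induction t)
  case (Suc t)
  have "\<gamma> + var_exp u + var_exp v + \<beta> = (\<gamma> + \<beta>) + var_exp u + var_exp v" for \<gamma> \<beta> u v
    by (simp add: ac_simps)
  with Suc show ?case unfolding up_closed_def by fastforce
qed (simp add: up_closed_def)

lemma simple_graph_edgeD: "simple_graph E \<Longrightarrow> {u, v} \<in> E \<Longrightarrow> u \<noteq> v"
  by (auto simp: simple_graph_def)

text \<open>If w has no neighbour in the support of \<beta>, it belongs to none of the t edges whose
  product divides \<beta>. So it occurs in the cofactor and can be cancelled there.\<close>

lemma edge_exponents_cancel:
  assumes "simple_graph E" "\<beta> \<in> edge_exponents E t" "\<beta> = \<alpha> + var_exp w"
    and "\<And>u. u \<in> Poly_Mapping.keys \<beta> \<Longrightarrow> {w, u} \<notin> E"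
  shows "\<alpha> \<in> edge_exponents E t"
  using assms(2-)
proof (induction t arbitrary: \<alpha> \<beta>)
  case (Suc t)
  then obtain \<gamma> u v where *: "\<beta> = \<gamma> + var_exp u + var_exp v" "\<gamma> \<in> edge_exponents E t" "{u, v} \<in> E"
    by auto
  have "u \<in> Poly_Mapping.keys \<beta>" "v \<in> Poly_Mapping.keys \<beta>"
    using *(1) by (simp_all add: keys_add_exp)
  moreover have "w \<in> Poly_Mapping.keys \<beta>" using Suc.prems(2) by (simp add: keys_add_exp)
  ultimately have "w \<noteq> u" "w \<noteq> v" using Suc.prems(3)[of u] Suc.prems(3)[of v] *(3) by (auto simp: insert_commute)
  with * \<open>w \<in> Poly_Mapping.keys \<beta>\<close> have "w \<in> Poly_Mapping.keys \<gamma>" by (auto simp: keys_add_exp)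
  then have \<gamma>: "\<gamma> = (\<gamma> - var_exp w) + var_exp w" by (simp add: exponent_split)
  have "\<gamma> - var_exp w \<in> edge_exponents E t"
    by (rule Suc.IH[OF *(2) \<gamma>]) (use Suc.prems(3) * in \<open>auto simp: keys_add_exp\<close>)
  moreover have "\<alpha> = (\<gamma> - var_exp w) + var_exp u + var_exp v"
  proof -
    have "\<alpha> + var_exp w = \<gamma> + var_exp u + var_exp v" using * Suc.prems(2) by simp
    also have "\<dots> = (\<gamma> - var_exp w) + var_exp u + var_exp v + var_exp w"
      by (subst \<gamma>) (simp only: ac_simps)
    finally show ?thesis by simp
  qed
  ultimately show ?case using *(3) by auto
qed simp

section \<open>Connected components\<close>

lemma adjacency_equiv: "equiv UNIV ({(u, v). {u, v} \<in> E}\<^sup>*)"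
  by (intro equivI sym_rtrancl refl_rtrancl trans_rtrancl)
    (auto simp: sym_def insert_commute refl_on_def)

lemma components_Union: "\<Union>(connected_components E) = UNIV"
  unfolding connected_components_def by (rule Union_quotient[OF adjacency_equiv])

lemma components_disjoint:
  "C \<in> connected_components E \<Longrightarrow> D \<in> connected_components E \<Longrightarrow> x \<in> C \<Longrightarrow> x \<in> D \<Longrightarrow> C = D"
  unfolding connected_components_def using quotient_disj[OF adjacency_equiv] by blast

lemma components_nonempty: "C \<in> connected_components E \<Longrightarrow> C \<noteq> {}"
  unfolding connected_components_def by (rule in_quotient_imp_non_empty[OF adjacency_equiv])

lemma components_edge:
  assumes "C \<in> connected_components E" "{u, v} \<in> E" "u \<in> C"
  shows "v \<in> C"
  using in_quotient_imp_closed[OF adjacency_equiv assms(1)[unfolded connected_components_def] assms(3), of v] assms(2)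
  by auto

text \<open>Edges in distinct components are disjoint, so dividing by one of them leaves the support
  in the other components intact.\<close>

lemma edge_exponentsI:
  assumes "simple_graph E" "B \<subseteq> connected_components (E :: 'v::finite set set)"
    and "\<And>C. C \<in> B \<Longrightarrow> \<exists>u\<in>C. \<exists>v\<in>C. {u, v} \<in> E \<and> u \<in> Poly_Mapping.keys \<alpha> \<and> v \<in> Poly_Mapping.keys \<alpha>"
  shows "\<alpha> \<in> edge_exponents E (card B)"
proof -
  have "finite B" by simp
  then show ?thesis using assms(2,3)
  proof (induction B arbitrary: \<alpha> rule: finite_induct)
    case (insert C B)
    obtain u v where uv: "u \<in> C" "v \<in> C" "{u, v} \<in> E" "u \<in> Poly_Mapping.keys \<alpha>" "v \<in> Poly_Mapping.keys \<alpha>"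
      using insert.prems(2) by blast
    then have "u \<noteq> v" using simple_graph_edgeD[OF assms(1)] by blast
    define \<gamma> where "\<gamma> = \<alpha> - var_exp u - var_exp v"
    have "v \<in> Poly_Mapping.keys (\<alpha> - var_exp u)"
      using uv \<open>u \<noteq> v\<close> by (simp add: in_keys_iff lookup_minus lookup_single)
    then have \<alpha>: "\<alpha> = \<gamma> + var_exp u + var_exp v"
      using exponent_split[OF uv(4)] exponent_split[of v "\<alpha> - var_exp u"]
      by (simp add: \<gamma>_def add.assoc add.commute[of "var_exp u"]) (simp flip: add.assoc)
    have "\<gamma> \<in> edge_exponents E (card B)"
    proof (rule insert.IH)
      fix D assume D: "D \<in> B"
      obtain a b where ab: "a \<in> D" "b \<in> D" "{a, b} \<in> E" "a \<in> Poly_Mapping.keys \<alpha>" "b \<in> Poly_Mapping.keys \<alpha>"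
        using insert.prems(2) D by blast
      have "C \<noteq> D" using insert.hyps D by auto
      then have "u \<notin> D" "v \<notin> D" using components_disjoint[of C E D] uv insert.prems(1) D by auto
      then have "w \<in> Poly_Mapping.keys \<gamma>" if "w \<in> D" "w \<in> Poly_Mapping.keys \<alpha>" for w
        using that by (auto simp: \<alpha> keys_add_exp)
      then show "\<exists>a\<in>D. \<exists>b\<in>D. {a, b} \<in> E \<and> a \<in> Poly_Mapping.keys \<gamma> \<and> b \<in> Poly_Mapping.keys \<gamma>"
        using ab by blast
    qed (use insert.prems in auto)
    then show ?case using insert.hyps uv \<alpha> by auto
  qed simp
qed

text \<open>An arbitrary injection \<open>rank\<close> serves twice: as an order that singles out a
  vertex of each component, and as bit positions for encoding vertex sets.\<close>

locale ranked_graph =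
  fixes E :: "'v::finite set set" and rank :: "'v \<Rightarrow> nat"
  assumes simple: "simple_graph E" and inj: "inj rank"
begin

abbreviation comps :: "'v set set" where
  "comps \<equiv> connected_components E"

definition base_vertex :: "'v set \<Rightarrow> 'v" where
  "base_vertex C = arg_min_on rank C"

text \<open>A component disjoint from the support is represented by its base vertex \<open>b\<close>, so that
  the exponent \<open>0\<close> lies in the same class as the powers of \<open>b\<close>: otherwise multiplication by \<open>y\<^sub>C\<close> would
  act as zero on the class of \<open>0\<close>.\<close>

definition marked :: "('v \<Rightarrow>\<^sub>0 nat) \<Rightarrow> 'v set" where
  "marked \<alpha> = Poly_Mapping.keys \<alpha> \<union> {base_vertex C | C. C \<in> comps \<and> Poly_Mapping.keys \<alpha> \<inter> C = {}}"

text \<open>A binary encoding: it determines the marked set, and it grows when a base vertex, having the least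
  rank in its component, is replaced by another vertex.\<close>

definition marking_code :: "('v \<Rightarrow>\<^sub>0 nat) \<Rightarrow> nat" where
  "marking_code \<alpha> = (\<Sum>v\<in>marked \<alpha>. 2 ^ rank v)"

lemma base_vertex_in: "C \<in> comps \<Longrightarrow> base_vertex C \<in> C"
  unfolding base_vertex_def by (intro arg_min_if_finite(1) components_nonempty) simp_all

lemma base_vertex_least: "C \<in> comps \<Longrightarrow> v \<in> C \<Longrightarrow> v \<noteq> base_vertex C \<Longrightarrow> rank (base_vertex C) < rank v"
proof -
  assume "C \<in> comps" "v \<in> C" "v \<noteq> base_vertex C"
  then have "rank (base_vertex C) \<le> rank v" "rank (base_vertex C) \<noteq> rank v"
    using arg_min_least[of C v rank] by (auto simp: base_vertex_def inj_eq[OF inj])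
  then show ?thesis by simp
qed

text \<open>Base vertices of other components lie outside C, so the part in C depends only on the
  support in C. Marked sets can thus be compared component by component.\<close>

lemma marked_Int:
  assumes "C \<in> comps"
  shows "marked \<alpha> \<inter> C = (if Poly_Mapping.keys \<alpha> \<inter> C = {} then {base_vertex C} else Poly_Mapping.keys \<alpha> \<inter> C)"
proof -
  have "D = C" if "D \<in> comps" "base_vertex D \<in> C" for D
    using components_disjoint[OF that(1) assms base_vertex_in[OF that(1)] that(2)] .
  then have "{base_vertex D | D. D \<in> comps \<and> Poly_Mapping.keys \<alpha> \<inter> D = {}} \<inter> C =
    (if Poly_Mapping.keys \<alpha> \<inter> C = {} then {base_vertex C} else {})"
    using assms base_vertex_in[OF assms] by auto
  then show ?thesis by (simp add: marked_def Int_Un_distrib2)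
qed

lemma marked_Int_cong:
  "C \<in> comps \<Longrightarrow> Poly_Mapping.keys \<alpha> \<inter> C = Poly_Mapping.keys \<beta> \<inter> C \<Longrightarrow> marked \<alpha> \<inter> C = marked \<beta> \<inter> C"
  by (simp add: marked_Int)

lemma set_eq_componentwise:
  assumes "\<And>C. C \<in> comps \<Longrightarrow> A \<inter> C = B \<inter> C"
  shows "A = B"
proof -
  have "A = A \<inter> \<Union>comps" "B = B \<inter> \<Union>comps" by (simp_all add: components_Union)
  then show ?thesis using assms by blast
qed

lemma in_component: obtains C where "C \<in> comps" "v \<in> C"
  using components_Union[of E] by blast

text \<open>The base vertex of an unsupported component is a placeholder, which the first vertex to
  enter the support replaces, possibly by itself.\<close>

lemma marked_add:
  assumes "C \<in> comps" "v \<in> C"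
  shows "marked (\<alpha> + var_exp v) =
    (if Poly_Mapping.keys \<alpha> \<inter> C = {} then insert v (marked \<alpha> - {base_vertex C}) else insert v (marked \<alpha>))"
proof (rule set_eq_componentwise)
  fix D assume D: "D \<in> comps"
  show "marked (\<alpha> + var_exp v) \<inter> D =
    (if Poly_Mapping.keys \<alpha> \<inter> C = {} then insert v (marked \<alpha> - {base_vertex C}) else insert v (marked \<alpha>)) \<inter> D"
  proof (cases "D = C")
    case True
    then show ?thesis
      using assms marked_Int[OF assms(1), of \<alpha>] marked_Int[OF assms(1), of "\<alpha> + var_exp v"]
      by (auto simp: keys_add_exp split: if_splits)
  next
    case False
    then have "v \<notin> D" "base_vertex C \<notin> D" using components_disjoint[OF assms(1) D] assms base_vertex_in by auto
    moreover from this have "marked (\<alpha> + var_exp v) \<inter> D = marked \<alpha> \<inter> D"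
      using D by (intro marked_Int_cong) (auto simp: keys_add_exp)
    ultimately show ?thesis by auto
  qed
qed

lemma marked_add_marked: "v \<in> marked \<alpha> \<Longrightarrow> marked (\<alpha> + var_exp v) = marked \<alpha>"
proof -
  assume v: "v \<in> marked \<alpha>"
  obtain C where C: "C \<in> comps" "v \<in> C" by (rule in_component)
  then have "v \<in> marked \<alpha> \<inter> C" using v by simp
  then show ?thesis
    using marked_add[OF C, of \<alpha>] marked_Int[OF C(1), of \<alpha>] by (cases "Poly_Mapping.keys \<alpha> \<inter> C = {}") auto
qed

lemma marking_code_add_unmarked:
  assumes "v \<notin> marked \<alpha>"
  shows "marking_code \<alpha> < marking_code (\<alpha> + var_exp v)"
proof -
  obtain C where C: "C \<in> comps" "v \<in> C" by (rule in_component)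
  show ?thesis
  proof (cases "Poly_Mapping.keys \<alpha> \<inter> C = {}")
    case True
    then have r: "base_vertex C \<in> marked \<alpha>" using C by (auto simp: marked_def)
    then have "marking_code \<alpha> = 2 ^ rank (base_vertex C) + (\<Sum>v\<in>marked \<alpha> - {base_vertex C}. 2 ^ rank v)"
      by (simp add: marking_code_def sum.remove)
    also have "\<dots> < 2 ^ rank v + (\<Sum>v\<in>marked \<alpha> - {base_vertex C}. 2 ^ rank v)"
      using base_vertex_least[OF C] r assms by auto
    also have "\<dots> = marking_code (\<alpha> + var_exp v)"
      using marked_add[OF C, of \<alpha>] True assms by (simp add: marking_code_def)
    finally show ?thesis .
  next
    case False
    then show ?thesis using marked_add[OF C, of \<alpha>] assms by (simp add: marking_code_def)
  qed
qed

lemma marking_code_add: "marking_code \<alpha> \<le> marking_code (\<alpha> + var_exp v)"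
  using marking_code_add_unmarked[of v \<alpha>] marked_add_marked[of v \<alpha>] by (cases "v \<in> marked \<alpha>") (auto simp: marking_code_def)

lemma marking_code_eq_imp_marked_eq:
  assumes "marking_code \<alpha> = marking_code \<beta>"
  shows "marked \<alpha> = marked \<beta>"
proof -
  have "marking_code \<gamma> = set_encode (rank ` marked \<gamma>)" for \<gamma>
    unfolding marking_code_def set_encode_def using inj by (subst sum.reindex) (auto intro: inj_on_subset)
  then have "set_encode (rank ` marked \<alpha>) = set_encode (rank ` marked \<beta>)" using assms by simp
  then have "rank ` marked \<alpha> = rank ` marked \<beta>" by (simp add: set_encode_eq)
  then show ?thesis using inj by (simp add: inj_image_eq_iff)
qed

text \<open>A descending chain of monomial ideals from R at r = 0 to I^t for large r. The step from
  r to r + 1 removes the monomials outside I^t that have code r, hence one common marked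
  set.\<close>

definition stratum :: "nat \<Rightarrow> nat \<Rightarrow> ('v \<Rightarrow>\<^sub>0 nat) set" where
  "stratum t r = edge_exponents E t \<union> {\<alpha>. r \<le> marking_code \<alpha>}"

lemma up_closed_stratum: "up_closed (stratum t r)"
proof (rule up_closedI)
  fix \<alpha> v assume "\<alpha> \<in> stratum t r"
  then show "\<alpha> + var_exp v \<in> stratum t r"
    using up_closed_edge_exponents[of E t] order_trans[OF _ marking_code_add, of r \<alpha> v]
    by (auto simp: stratum_def up_closed_def)
qed

text \<open>The components to avoid are those with an edge inside the support; more than t of them
  would put \<alpha> into the edge exponents. Independence is stated for the marked set because all
  exponents of a graded piece share it; an unsupported component contributes a single
  vertex.\<close>

lemma independent_components:
  assumes "\<alpha> \<notin> edge_exponents E t"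
  obtains Z where "Z \<subseteq> comps" "card Z = card comps - t"
    "\<And>C u v. C \<in> Z \<Longrightarrow> {u, v} \<in> E \<Longrightarrow> u \<in> marked \<alpha> \<inter> C \<Longrightarrow> v \<notin> marked \<alpha> \<inter> C"
proof -
  define bad where "bad = {C \<in> comps. \<exists>u\<in>C. \<exists>v\<in>C. {u, v} \<in> E \<and> u \<in> Poly_Mapping.keys \<alpha> \<and> v \<in> Poly_Mapping.keys \<alpha>}"
  have "card bad \<le> t"
  proof (rule ccontr)
    assume "\<not> card bad \<le> t"
    then have "t \<le> card bad" by simp
    then obtain B where B: "B \<subseteq> bad" "card B = t" by (meson obtain_subset_with_card_n)
    have "\<alpha> \<in> edge_exponents E (card B)"
      using B(1) by (intro edge_exponentsI simple) (auto simp: bad_def)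
    with assms B show False by simp
  qed
  moreover have "card (comps - bad) = card comps - card bad"
    by (intro card_Diff_subset) (auto simp: bad_def)
  ultimately have "card comps - t \<le> card (comps - bad)" by simp
  then obtain Z where Z: "Z \<subseteq> comps - bad" "card Z = card comps - t" by (meson obtain_subset_with_card_n)
  show ?thesis
  proof (rule that)
    fix C u v assume *: "C \<in> Z" "{u, v} \<in> E" "u \<in> marked \<alpha> \<inter> C"
    then have C: "C \<in> comps" "C \<notin> bad" using Z by auto
    show "v \<notin> marked \<alpha> \<inter> C"
    proof
      assume v: "v \<in> marked \<alpha> \<inter> C"
      show False
      proof (cases "Poly_Mapping.keys \<alpha> \<inter> C = {}")
        case True
        then have "u = v" using * v marked_Int[OF C(1), of \<alpha>] by simp
        then show False using simple_graph_edgeD[OF simple *(2)] by simp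
      next
        case False
        then have "u \<in> Poly_Mapping.keys \<alpha> \<inter> C" "v \<in> Poly_Mapping.keys \<alpha> \<inter> C"
          using * v marked_Int[OF C(1), of \<alpha>] by auto
        then show False using C *(2) by (auto simp: bad_def)
      qed
    qed
  qed (use Z in auto)
qed

abbreviation comp_sum :: "'v set \<Rightarrow> ('v, 'k::field) mpoly" where
  "comp_sum C \<equiv> \<Sum>v\<in>C. indet v"

definition esym_params :: "nat \<Rightarrow> ('v, 'k::field) mpoly list" where
  "esym_params d = map (esym comp_sum comps) (rev [1..<Suc d])"

text \<open>Homogeneity serves the limit argument, and positive degree puts the sequence into
  \<open>max_ideal\<close>.\<close>

lemma homogeneous_esym_params: "\<theta> \<in> set (esym_params d) \<Longrightarrow> \<exists>e>0. homogeneous e \<theta>"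
proof -
  assume "\<theta> \<in> set (esym_params d)"
  then obtain e where "\<theta> = esym comp_sum comps e" "e \<in> {1..d}" by (auto simp: esym_params_def)
  moreover have "homogeneous e (esym comp_sum comps e :: ('v, 'k::field) mpoly)" for e
    by (intro homogeneous_esym homogeneous_sum homogeneous_indet)
  ultimately show ?thesis by (intro exI[of _ e]) simp
qed

lemma weakly_regular_stratum:
  "weakly_regular (esym_params (card comps - t)) (monomial_span (stratum t r)) (monomial_span (stratum t (Suc r)) :: ('v, 'k::field) mpoly set)"
proof (cases "\<exists>\<alpha>. \<alpha> \<notin> edge_exponents E t \<and> marking_code \<alpha> = r")
  case False
  then have "stratum t r = stratum t (Suc r)" by (auto simp: stratum_def Suc_le_eq order_less_le)
  then show ?thesis by (simp add: weakly_regular_refl is_ideal_monomial_span up_closed_stratum)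
next
  case True
  \<comment> \<open>One representative determines the choices for the whole piece, since all its
    exponents have the same marked set.\<close>
  then obtain \<alpha>\<^sub>0 where \<alpha>\<^sub>0: "\<alpha>\<^sub>0 \<notin> edge_exponents E t" "marking_code \<alpha>\<^sub>0 = r" by blast
  obtain Z where Z: "Z \<subseteq> comps" "card Z = card comps - t"
    "\<And>C u v. C \<in> Z \<Longrightarrow> {u, v} \<in> E \<Longrightarrow> u \<in> marked \<alpha>\<^sub>0 \<inter> C \<Longrightarrow> v \<notin> marked \<alpha>\<^sub>0 \<inter> C"
    by (rule independent_components[OF \<alpha>\<^sub>0(1)]) blast
  define W where "W = marked \<alpha>\<^sub>0"
  have "\<exists>v. v \<in> W \<inter> C" if "C \<in> Z" for C
    using marked_Int[of C \<alpha>\<^sub>0] that Z(1) unfolding W_def by fastforce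
  then obtain h where h: "\<And>C. C \<in> Z \<Longrightarrow> h C \<in> W \<inter> C" by metis
  \<comment> \<open>Multiplication by a vertex raises \<open>off\<close> unless the vertex is
    chosen. So on a slice where \<open>off\<close> is constant, all other vertices act as
    zero.\<close>
  define off where "off \<alpha> = (\<Sum>v\<in>- (h ` Z). Poly_Mapping.lookup \<alpha> v)" for \<alpha> :: "'v \<Rightarrow>\<^sub>0 nat"
  have off_add: "off (\<alpha> + var_exp v) = off \<alpha> + (if v \<in> h ` Z then 0 else 1)" for \<alpha> v
    by (simp add: off_def lookup_add sum.distrib lookup_single when_def)
  define K where "K = {\<alpha>. \<alpha> \<notin> edge_exponents E t \<and> marking_code \<alpha> = r}"
  have marked_K: "marked \<alpha> = W" if "\<alpha> \<in> K" for \<alpha>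
    using that \<alpha>\<^sub>0 marking_code_eq_imp_marked_eq[of \<alpha> \<alpha>\<^sub>0] by (simp add: K_def W_def)
  have K_add: "\<alpha> + var_exp v \<in> K \<union> stratum t (Suc r)" if "\<alpha> \<in> K" for \<alpha> v
    using that marking_code_add[of \<alpha> v] by (auto simp: K_def stratum_def)
  have K_shift: "\<alpha> + var_exp (h C) \<in> K" if "\<alpha> \<in> K" "C \<in> Z" for \<alpha> C
  proof -
    have "h C \<in> marked \<alpha>" using h that marked_K by auto
    then have m: "marked (\<alpha> + var_exp (h C)) = marked \<alpha>" by (rule marked_add_marked)
    \<comment> \<open>Neighbours of \<open>h C\<close> lie in C, where the marked set is
      independent, so none of them is in the support and \<open>h C\<close> can be
      cancelled.\<close>
    have "\<alpha> + var_exp (h C) \<notin> edge_exponents E t"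
    proof
      assume "\<alpha> + var_exp (h C) \<in> edge_exponents E t"
      then have "\<alpha> \<in> edge_exponents E t"
      proof (rule edge_exponents_cancel[OF simple _ refl])
        fix u assume u: "u \<in> Poly_Mapping.keys (\<alpha> + var_exp (h C))"
        show "{h C, u} \<notin> E"
        proof
          assume e: "{h C, u} \<in> E"
          then have "u \<in> C" using components_edge[of C E "h C" u] h that Z(1) by auto
          moreover have "u \<in> W" using u m marked_K[OF that(1)] by (auto simp: marked_def)
          ultimately show False using Z(3)[OF that(2) e] h[OF that(2)] by (simp add: W_def)
        qed
      qed
      then show False using that by (simp add: K_def)
    qed
    then show ?thesis using that m by (simp add: K_def marking_code_def)
  qed
  define T where "T n = stratum t (Suc r) \<union> {\<alpha> \<in> K. n \<le> off \<alpha>}" for n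
  have up_T: "up_closed (T n)" for n
  proof (rule up_closedI)
    fix \<alpha> v assume "\<alpha> \<in> T n"
    then show "\<alpha> + var_exp v \<in> T n"
      using up_closed_stratum[of t "Suc r"] K_add[of \<alpha> v] off_add[of \<alpha> v]
      by (auto simp: T_def up_closed_def)
  qed
  have T_mono: "T n \<subseteq> T 0" "T (Suc n) \<subseteq> T n" for n by (auto simp: T_def)
  have T_0: "T 0 = stratum t r"
    by (auto simp: T_def K_def stratum_def Suc_le_eq order_less_le)
  have K_disjoint: "K \<inter> stratum t (Suc r) = {}" by (auto simp: K_def stratum_def)
  have step: "weakly_regular (esym_params (card comps - t)) (monomial_span (T n)) (monomial_span (T (Suc n)) :: ('v, 'k) mpoly set)" for n
  proof -
    define L where "L = {\<alpha> \<in> K. off \<alpha> = n}"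
    have L: "L \<union> T (Suc n) = T n" by (auto simp: L_def T_def)
    have "weakly_regular (map (esym comp_sum comps) (rev [1..<Suc (card Z)]))
      (monomial_span (L \<union> T (Suc n))) (monomial_span (T (Suc n)) :: ('v, 'k) mpoly set)"
    proof (rule weakly_regular_monomial_span[where A = "\<lambda>C. C" and h = h])
      show "up_closed (T (Suc n))" "up_closed (L \<union> T (Suc n))" by (simp_all add: L up_T)
      show "h C \<in> C" if "C \<in> Z" for C using h that by auto
      show "\<alpha> + var_exp v \<in> T (Suc n)"
        if "\<alpha> \<in> L" "C \<in> comps" "v \<in> C" "C \<in> Z \<Longrightarrow> v \<noteq> h C" for \<alpha> C v
      proof -
        have "v \<notin> h ` Z"
        proof
          assume "v \<in> h ` Z"
          then obtain D where D: "D \<in> Z" "v = h D" by auto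
          then have "C = D" using components_disjoint[of C E D v] that(2,3) h Z(1) by auto
          then show False using D that(4) by simp
        qed
        then show ?thesis using that(1) K_add[of \<alpha> v] off_add[of \<alpha> v] by (auto simp: T_def L_def)
      qed
      show "\<alpha> + var_exp (h C) \<notin> T (Suc n)" if "\<alpha> \<in> L" "C \<in> Z" for \<alpha> C
        using K_shift[of \<alpha> C] K_disjoint off_add[of \<alpha> "h C"] that by (auto simp: T_def L_def)
      show "\<exists>\<gamma>'\<in>L \<union> T (Suc n). \<alpha> = \<gamma>' + var_exp (h D)"
        if "\<alpha> \<in> L" "\<gamma> \<in> L" "C \<in> Z" "D \<in> Z" "C \<noteq> D" and eq: "\<alpha> + var_exp (h C) = \<gamma> + var_exp (h D)"
        for \<alpha> \<gamma> C D
      proof -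
        have hC: "h C \<notin> D" "h D \<notin> C"
          using components_disjoint[of C E D] h that Z(1) by blast+
        then have neq: "h C \<noteq> h D" using h that by auto
        have "h D \<in> Poly_Mapping.keys (\<alpha> + var_exp (h C))" by (simp add: eq keys_add_exp)
        then have "h D \<in> Poly_Mapping.keys \<alpha>" using neq by (auto simp: keys_add_exp)
        \<comment> \<open>Dividing \<alpha> by \<open>h D\<close> gives the same as dividing
          \<gamma> by \<open>h C\<close>. It remains to see that this quotient lies in the same
          slice.\<close>
        define \<gamma>' where "\<gamma>' = \<alpha> - var_exp (h D)"
        have \<alpha>': "\<alpha> = \<gamma>' + var_exp (h D)"
          using \<open>h D \<in> Poly_Mapping.keys \<alpha>\<close> by (simp add: \<gamma>'_def exponent_split)
        have "\<gamma>' + var_exp (h C) + var_exp (h D) = \<gamma> + var_exp (h D)"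
          using eq by (subst (asm) \<alpha>') (simp add: ac_simps)
        then have \<gamma>: "\<gamma> = \<gamma>' + var_exp (h C)" by simp
        have "marked \<gamma>' = W"
        proof (rule set_eq_componentwise)
          fix B assume B: "B \<in> comps"
          \<comment> \<open>The quotient has the support of \<gamma> except possibly at
            \<open>h C\<close>, and that of \<alpha> except possibly at \<open>h D\<close>; no
            component contains both vertices.\<close>
          have "marked \<gamma>' \<inter> B = marked \<gamma> \<inter> B \<or> marked \<gamma>' \<inter> B = marked \<alpha> \<inter> B"
          proof (cases "h C \<in> B")
            case True
            then have "h D \<notin> B" using components_disjoint[of C E B "h C"] B that Z(1) h hC by auto
            then show ?thesis using B by (intro disjI2 marked_Int_cong) (auto simp: \<alpha>' keys_add_exp)
          next
            case False
            then show ?thesis using B by (intro disjI1 marked_Int_cong) (auto simp: \<gamma> keys_add_exp)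
          qed
          then show "marked \<gamma>' \<inter> B = W \<inter> B" using marked_K that by (auto simp: L_def)
        qed
        then have "marking_code \<gamma>' = r" using \<alpha>\<^sub>0 by (simp add: marking_code_def W_def)
        moreover have "\<gamma>' \<notin> edge_exponents E t"
          using up_closed_edge_exponents[of E t] that(1) \<alpha>' by (auto simp: up_closed_def L_def K_def)
        moreover have "off \<gamma>' = n"
          using off_add[of \<gamma>' "h D"] that(1,4) \<alpha>' by (simp add: L_def)
        ultimately have "\<gamma>' \<in> L" by (simp add: L_def K_def)
        then show ?thesis using \<alpha>' by blast
      qed
    qed (use Z in auto)
    then show ?thesis unfolding L by (simp add: esym_params_def Z(2))
  qed
  have "weakly_regular (esym_params (card comps - t)) (monomial_span (T 0)) (monomial_span (T n) :: ('v, 'k) mpoly set)" for n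
  proof (induction n)
    case 0
    show ?case by (simp add: weakly_regular_refl is_ideal_monomial_span up_T)
  next
    case (Suc n)
    show ?case
      by (rule weakly_regular_trans[OF _ _ _ _ _ Suc step])
        (use T_mono in \<open>simp_all add: is_ideal_monomial_span up_T monomial_span_mono\<close>)
  qed
  then show ?thesis
    unfolding T_0
  proof (rule weakly_regular_limit[rotated -1])
    fix n
    show "monomial_span (stratum t (Suc r)) \<subseteq> (monomial_span (T n) :: ('v, 'k) mpoly set)" by (auto simp: monomial_span_def T_def)
    \<comment> \<open>Hence what \<open>T n\<close> adds to the next stratum has degree at least n,
      as the limit lemma requires.\<close>
    have "off \<alpha> \<le> total_degree \<alpha>" for \<alpha>
      unfolding off_def total_degree_def by (rule sum_mono2) auto
    then have "T n \<subseteq> stratum t (Suc r) \<union> {\<alpha>. n \<le> total_degree \<alpha>}"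
      by (auto simp: T_def intro: order_trans)
    then show "(monomial_span (T n) :: ('v, 'k) mpoly set) \<subseteq> monomial_span (stratum t (Suc r)) + monomial_span {\<alpha>. n \<le> total_degree \<alpha>}"
      unfolding monomial_span_plus by (auto simp: monomial_span_def)
  qed (use homogeneous_esym_params in \<open>auto simp: graded_monomial_span\<close>)
qed

lemma weakly_regular_edge_exponents:
  "weakly_regular (esym_params (card comps - t)) UNIV (monomial_span (edge_exponents E t) :: ('v, 'k::field) mpoly set)"
proof -
  have stratum_mono: "stratum t (Suc r) \<subseteq> stratum t r" for r by (auto simp: stratum_def)
  have all: "weakly_regular (esym_params (card comps - t)) UNIV (monomial_span (stratum t r) :: ('v, 'k) mpoly set)" for r
  proof (induction r)
    case 0
    have "monomial_span (stratum t 0) = (UNIV :: ('v, 'k) mpoly set)" by (auto simp: monomial_span_def stratum_def)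
    then show ?case by (simp add: weakly_regular_refl is_ideal_UNIV)
  next
    case (Suc r)
    show ?case
      by (rule weakly_regular_trans[OF _ _ _ _ _ Suc weakly_regular_stratum])
        (use stratum_mono in \<open>simp_all add: is_ideal_monomial_span is_ideal_UNIV up_closed_stratum monomial_span_mono\<close>)
  qed
  \<comment> \<open>The code of the full vertex set bounds all codes; beyond it the stratum is
    I^t.\<close>
  have "marking_code \<alpha> \<le> (\<Sum>v\<in>UNIV. 2 ^ rank v)" for \<alpha>
    unfolding marking_code_def by (rule sum_mono2) auto
  then have "stratum t (Suc (\<Sum>v\<in>UNIV. 2 ^ rank v)) = edge_exponents E t"
    by (auto simp: stratum_def not_less_eq_eq[symmetric])
  then show ?thesis using all[of "Suc (\<Sum>v\<in>UNIV. 2 ^ rank v)"] by simp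
qed

end

section \<open>Depth of a quotient ring\<close>

lemma ring_of_type_algebra_simps [simp]:
  "carrier ring_of_type_algebra = UNIV"
  "x \<otimes>\<^bsub>ring_of_type_algebra\<^esub> y = x * y"
  "x \<oplus>\<^bsub>ring_of_type_algebra\<^esub> y = x + y"
  "\<zero>\<^bsub>ring_of_type_algebra\<^esub> = 0"
  "\<one>\<^bsub>ring_of_type_algebra\<^esub> = 1"
  by (simp_all add: ring_of_type_algebra_def)

lemma a_inv_ring_of_type_algebra: "\<ominus>\<^bsub>ring_of_type_algebra\<^esub> x = - (x :: 'a::comm_ring_1)"
proof -
  interpret ring "ring_of_type_algebra :: 'a ring" by (rule ring_from_type_algebra)
  show ?thesis by (rule minus_equality) simp_all
qed

text \<open>Links ideals as sets in a type-class ring to ideals of the ring record, in terms of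
  which depth is defined.\<close>

lemma ideal_iff_is_ideal: "ideal I (ring_of_type_algebra :: 'a::comm_ring_1 ring) \<longleftrightarrow> is_ideal I"
proof
  assume "ideal I (ring_of_type_algebra :: 'a ring)"
  then interpret I: ideal I "ring_of_type_algebra :: 'a ring" .
  have *: "additive_subgroup I (ring_of_type_algebra :: 'a ring)" by (rule I.is_additive_subgroup)
  show "is_ideal I"
    using additive_subgroup.zero_closed[OF *] additive_subgroup.a_closed[OF *] I.I_l_closed
    by (intro is_idealI) simp_all
next
  assume I: "is_ideal I"
  interpret ring "ring_of_type_algebra :: 'a ring" by (rule ring_from_type_algebra)
  show "ideal I (ring_of_type_algebra :: 'a ring)"
  proof (rule idealI[OF ring_axioms])
    show "subgroup I (add_monoid (ring_of_type_algebra :: 'a ring))"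
    proof (rule add.subgroupI)
      show "\<ominus>\<^bsub>ring_of_type_algebra\<^esub> a \<in> I" if "a \<in> I" for a
        using is_ideal_uminus[OF I that] by (simp only: a_inv_ring_of_type_algebra)
    qed (use is_ideal_zero[OF I] is_ideal_add[OF I] in auto)
  qed (use is_ideal_mult[OF I] in \<open>auto simp: mult.commute\<close>)
qed

text \<open>The ideal J + (\<theta>s), built by the same recursion as \<open>weakly_regular\<close>
  with U = R.\<close>

fun ideal_extend :: "'a::comm_ring_1 list \<Rightarrow> 'a set \<Rightarrow> 'a set" where
  "ideal_extend [] J = J"
| "ideal_extend (\<theta> # \<theta>s) J = ideal_extend \<theta>s (J + \<theta> *o UNIV)"

lemma is_ideal_ideal_extend: "is_ideal J \<Longrightarrow> is_ideal (ideal_extend \<theta>s J)"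
  by (induction \<theta>s arbitrary: J) (simp_all add: is_ideal_plus_times is_ideal_UNIV)

lemma subset_ideal_extend: "J \<subseteq> ideal_extend \<theta>s J"
proof (induction \<theta>s arbitrary: J)
  case (Cons \<theta> \<theta>s)
  have "J \<subseteq> J + \<theta> *o UNIV"
    by (intro subset_plus_ideal is_ideal_times is_ideal_UNIV)
  with Cons[of "J + \<theta> *o UNIV"] show ?case by simp
qed simp

lemma mult_mem_ideal_extend: "is_ideal J \<Longrightarrow> \<theta> \<in> set \<theta>s \<Longrightarrow> \<theta> * x \<in> ideal_extend \<theta>s J"
proof (induction \<theta>s arbitrary: J)
  case (Cons \<phi> \<theta>s)
  show ?case
  proof (cases "\<theta> = \<phi>")
    case True
    have "0 + \<theta> * x \<in> J + \<phi> *o UNIV"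
      unfolding True by (intro set_plus_intro set_times_intro2 is_ideal_zero Cons.prems UNIV_I)
    then show ?thesis using subset_ideal_extend[of "J + \<phi> *o UNIV" \<theta>s] by auto
  next
    case False
    with Cons show ?thesis by (simp add: is_ideal_plus_times is_ideal_UNIV)
  qed
qed simp

lemma ideal_extend_minimal:
  assumes "is_ideal N" "J \<subseteq> N" "\<And>\<theta> x. \<theta> \<in> set \<theta>s \<Longrightarrow> \<theta> * x \<in> N"
  shows "ideal_extend \<theta>s J \<subseteq> N"
  using assms(2,3)
proof (induction \<theta>s arbitrary: J)
  case (Cons \<theta> \<theta>s)
  have "J + \<theta> *o UNIV \<subseteq> N"
    using Cons.prems assms(1) by (auto simp: mem_plus_times_iff intro!: is_ideal_add)
  with Cons show ?case by simp
qed simp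

lemma weakly_regular_nth:
  assumes "weakly_regular \<theta>s UNIV J" "i < length \<theta>s"
  shows "regular_on (\<theta>s ! i) UNIV (ideal_extend (take i \<theta>s) J)"
  using assms
proof (induction \<theta>s arbitrary: J i)
  case (Cons \<theta> \<theta>s)
  then show ?case by (cases i) simp_all
qed simp

section \<open>Submodules of R/J and regular sequences on it\<close>

context
  fixes J :: "'a::comm_ring_1 set" and R :: "'a ring" and M :: "('a, 'a set) module"
  assumes J: "is_ideal J"
  defines R: "R \<equiv> ring_of_type_algebra"
  defines M: "M \<equiv> quot_module ring_of_type_algebra J"
begin

interpretation J: ideal J R
  unfolding R using J by (simp add: ideal_iff_is_ideal)

lemma quot_module_simps:
  "carrier M = range (\<lambda>x. J +>\<^bsub>R\<^esub> x)"
  "\<zero>\<^bsub>M\<^esub> = J +>\<^bsub>R\<^esub> 0"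
  "(J +>\<^bsub>R\<^esub> x) \<oplus>\<^bsub>M\<^esub> (J +>\<^bsub>R\<^esub> y) = J +>\<^bsub>R\<^esub> (x + y)"
  "r \<odot>\<^bsub>M\<^esub> (J +>\<^bsub>R\<^esub> x) = J +>\<^bsub>R\<^esub> (r * x)"
proof -
  have R_simps: "carrier R = UNIV" "a \<otimes>\<^bsub>R\<^esub> b = a * b" "a \<oplus>\<^bsub>R\<^esub> b = a + b" "\<zero>\<^bsub>R\<^esub> = 0" for a b
    by (simp_all add: R)
  show "carrier M = range (\<lambda>x. J +>\<^bsub>R\<^esub> x)"
    by (auto simp: M quot_module_def FactRing_def A_RCOSETS_def' R_simps simp flip: R)
  have "J +>\<^bsub>R\<^esub> \<zero>\<^bsub>R\<^esub> = J" by (intro J.a_rcos_const) (simp add: R_simps J is_ideal_zero)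
  then show "\<zero>\<^bsub>M\<^esub> = J +>\<^bsub>R\<^esub> 0"
    by (simp add: M quot_module_def FactRing_def R_simps flip: R)
  show "(J +>\<^bsub>R\<^esub> x) \<oplus>\<^bsub>M\<^esub> (J +>\<^bsub>R\<^esub> y) = J +>\<^bsub>R\<^esub> (x + y)"
    using J.a_rcos_sum[of x y] by (simp add: M quot_module_def FactRing_def R_simps flip: R)
  show "r \<odot>\<^bsub>M\<^esub> (J +>\<^bsub>R\<^esub> x) = J +>\<^bsub>R\<^esub> (r * x)"
    using J.rcoset_mult_add[of r x] by (simp add: M quot_module_def FactRing_def R_simps flip: R)
qed

lemma coset_eq_iff: "J +>\<^bsub>R\<^esub> x = J +>\<^bsub>R\<^esub> y \<longleftrightarrow> x - y \<in> J"
proof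
  assume "J +>\<^bsub>R\<^esub> x = J +>\<^bsub>R\<^esub> y"
  moreover have "x \<in> J +>\<^bsub>R\<^esub> x" by (intro J.a_rcos_self) (simp add: R)
  ultimately have "x \<in> J +>\<^bsub>R\<^esub> y" by simp
  then show "x - y \<in> J" by (auto simp: a_r_coset_def' R)
next
  assume "x - y \<in> J"
  then have "a - x \<in> J \<longleftrightarrow> a - y \<in> J" for a
    using is_ideal_add[OF J, of "a - x" "x - y"] is_ideal_diff[OF J, of "a - y" "x - y"] by auto
  moreover have "a \<in> J +>\<^bsub>R\<^esub> z \<longleftrightarrow> a - z \<in> J" for a z
    by (force simp: a_r_coset_def' R)
  ultimately show "J +>\<^bsub>R\<^esub> x = J +>\<^bsub>R\<^esub> y" by blast
qed

lemma submodule_image: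
  assumes "is_ideal N"
  shows "submodule ((\<lambda>x. J +>\<^bsub>R\<^esub> x) ` N) R M"
proof -
  interpret M: module R M
    unfolding M R using J.quot_module_is_module cring_from_type_algebra unfolding R by blast
  show ?thesis
  proof (rule M.submoduleI)
    show "\<zero>\<^bsub>M\<^esub> \<in> (\<lambda>x. J +>\<^bsub>R\<^esub> x) ` N"
      using is_ideal_zero[OF assms] by (auto simp: quot_module_simps)
    show "\<ominus>\<^bsub>M\<^esub> a \<in> (\<lambda>x. J +>\<^bsub>R\<^esub> x) ` N" if a: "a \<in> (\<lambda>x. J +>\<^bsub>R\<^esub> x) ` N" for a
    proof -
      obtain x where x: "a = J +>\<^bsub>R\<^esub> x" "x \<in> N" using a by auto
      have "\<ominus>\<^bsub>M\<^esub> a = J +>\<^bsub>R\<^esub> (- x)"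
        by (rule M.minus_equality) (simp_all add: x quot_module_simps)
      then show ?thesis using is_ideal_uminus[OF assms x(2)] by auto
    qed
  qed (use is_ideal_add[OF assms] is_ideal_mult[OF assms] in \<open>auto simp: quot_module_simps\<close>)
qed

text \<open>The image of the extended ideal is one of the submodules in the intersection.
  Conversely, the preimage in R of any of these submodules is an ideal that contains J and all
  multiples of the \<theta>s, hence the extended ideal.\<close>

lemma set_smult_quot_module:
  "set_smult R M (set \<theta>s) = (\<lambda>x. J +>\<^bsub>R\<^esub> x) ` ideal_extend \<theta>s J"
proof
  show "set_smult R M (set \<theta>s) \<subseteq> (\<lambda>x. J +>\<^bsub>R\<^esub> x) ` ideal_extend \<theta>s J"
    unfolding set_smult_def
    by (rule Inter_lower)
      (auto simp: quot_module_simps mult_mem_ideal_extend J intro!: submodule_image is_ideal_ideal_extend)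
  show "(\<lambda>x. J +>\<^bsub>R\<^esub> x) ` ideal_extend \<theta>s J \<subseteq> set_smult R M (set \<theta>s)"
    unfolding set_smult_def
  proof (rule Inter_greatest)
    fix N assume "N \<in> {N. submodule N R M \<and> (\<forall>f\<in>set \<theta>s. \<forall>x\<in>carrier M. f \<odot>\<^bsub>M\<^esub> x \<in> N)}"
    then have sub: "submodule N R M" and gen: "\<And>f x. f \<in> set \<theta>s \<Longrightarrow> J +>\<^bsub>R\<^esub> (f * x) \<in> N"
      by (auto simp: quot_module_simps)
    interpret N: submodule N R M by (rule sub)
    have carrier_R: "carrier R = UNIV" by (simp add: R)
    have "J +>\<^bsub>R\<^esub> 0 \<in> N" using N.one_closed by (simp add: quot_module_simps)
    moreover have "J +>\<^bsub>R\<^esub> x = J +>\<^bsub>R\<^esub> 0" if "x \<in> J" for x using that by (simp add: coset_eq_iff)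
    ultimately have sub_J: "J \<subseteq> {x. J +>\<^bsub>R\<^esub> x \<in> N}" by auto
    have "is_ideal {x. J +>\<^bsub>R\<^esub> x \<in> N}"
    proof (rule is_idealI)
      show "0 \<in> {x. J +>\<^bsub>R\<^esub> x \<in> N}" using \<open>J +>\<^bsub>R\<^esub> 0 \<in> N\<close> by simp
      show "x + y \<in> {x. J +>\<^bsub>R\<^esub> x \<in> N}" if "x \<in> {x. J +>\<^bsub>R\<^esub> x \<in> N}" "y \<in> {x. J +>\<^bsub>R\<^esub> x \<in> N}" for x y
        using that N.m_closed[of "J +>\<^bsub>R\<^esub> x" "J +>\<^bsub>R\<^esub> y"] by (simp add: quot_module_simps)
      show "r * x \<in> {x. J +>\<^bsub>R\<^esub> x \<in> N}" if "x \<in> {x. J +>\<^bsub>R\<^esub> x \<in> N}" for r x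
        using that N.smult_closed[of r "J +>\<^bsub>R\<^esub> x"] carrier_R by (simp add: quot_module_simps)
    qed
    from ideal_extend_minimal[OF this sub_J] gen
    show "(\<lambda>x. J +>\<^bsub>R\<^esub> x) ` ideal_extend \<theta>s J \<subseteq> N" by auto
  qed
qed

lemma coset_mem_set_smult_iff:
  "J +>\<^bsub>R\<^esub> x \<in> set_smult R M (set \<theta>s) \<longleftrightarrow> x \<in> ideal_extend \<theta>s J"
proof
  assume "J +>\<^bsub>R\<^esub> x \<in> set_smult R M (set \<theta>s)"
  then obtain y where y: "y \<in> ideal_extend \<theta>s J" "x - y \<in> J"
    by (auto simp: set_smult_quot_module coset_eq_iff)
  then have "y + (x - y) \<in> ideal_extend \<theta>s J"
    using subset_ideal_extend by (intro is_ideal_add is_ideal_ideal_extend J) auto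
  then show "x \<in> ideal_extend \<theta>s J" by simp
qed (auto simp: set_smult_quot_module)

text \<open>The properness condition, absent from \<open>weakly_regular\<close>, returns as the
  condition on 1.\<close>

lemma regular_sequence_quot_module:
  assumes "weakly_regular \<theta>s UNIV J" "1 \<notin> ideal_extend \<theta>s J"
  shows "regular_sequence R M \<theta>s"
  unfolding regular_sequence_def
proof (intro conjI allI impI ballI)
  show "set \<theta>s \<subseteq> carrier R" by (simp add: R)
  have "J +>\<^bsub>R\<^esub> 1 \<in> carrier M" by (simp add: quot_module_simps)
  then show "set_smult R M (set \<theta>s) \<noteq> carrier M"
    using assms(2) coset_mem_set_smult_iff by metis
  fix i q assume *: "i < length \<theta>s" "q \<in> carrier M"
    "\<theta>s ! i \<odot>\<^bsub>M\<^esub> q \<in> set_smult R M (set (take i \<theta>s))"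
  then obtain x where "q = J +>\<^bsub>R\<^esub> x" by (auto simp: quot_module_simps)
  then show "q \<in> set_smult R M (set (take i \<theta>s))"
    using * weakly_regular_nth[OF assms(1) *(1)]
    by (simp add: quot_module_simps coset_mem_set_smult_iff regular_on_def)
qed

end

section \<open>Powers of edge ideals as monomial ideals\<close>

lemma poly_mapping_sum_single:
  fixes x :: "'a \<Rightarrow>\<^sub>0 'b::comm_monoid_add"
  shows "x = (\<Sum>\<alpha>\<in>Poly_Mapping.keys x. Poly_Mapping.single \<alpha> (Poly_Mapping.lookup x \<alpha>))"
  by (rule poly_mapping_eqI) (auto simp: lookup_sum lookup_single when_def sum.delta in_keys_iff)

lemma monomial_span_subset_ideal:
  fixes I :: "('v, 'k::field) mpoly set"
  assumes "is_ideal I" "\<And>\<alpha> c. \<alpha> \<in> S \<Longrightarrow> Poly_Mapping.single \<alpha> c \<in> I"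
  shows "monomial_span S \<subseteq> I"
proof
  fix x :: "('v, 'k) mpoly" assume "x \<in> monomial_span S"
  then have "(\<Sum>\<alpha>\<in>Poly_Mapping.keys x. Poly_Mapping.single \<alpha> (Poly_Mapping.lookup x \<alpha>)) \<in> I"
    by (intro is_ideal_sum assms) (auto simp: monomial_span_def)
  then show "x \<in> I" by (simp flip: poly_mapping_sum_single)
qed

text \<open>\<open>UNIV + G\<close> consists of the exponents divisible by an element of
  \<open>G\<close>.\<close>

lemma genideal_monomials:
  "Idl\<^bsub>mpoly_ring\<^esub> ((\<lambda>\<alpha>. Poly_Mapping.single \<alpha> 1) ` G) =
    (monomial_span (UNIV + G) :: ('v, 'k::field) mpoly set)" (is "?I = ?J")
proof
  interpret ring "mpoly_ring :: ('v, 'k) mpoly ring" by (rule ring_from_type_algebra)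
  have "up_closed (UNIV + G)"
    unfolding up_closed_def set_plus_def by (auto simp: ac_simps) (metis add.assoc add.commute)
  then have "ideal ?J mpoly_ring" by (simp add: ideal_iff_is_ideal is_ideal_monomial_span)
  moreover have "Poly_Mapping.single \<alpha> 1 \<in> ?J" if "\<alpha> \<in> G" for \<alpha>
    using set_plus_intro[of 0 UNIV \<alpha> G] that by (simp add: monomial_span_def)
  ultimately show "?I \<subseteq> ?J" by (intro genideal_minimal) auto
  have I: "is_ideal ?I" using genideal_ideal by (simp flip: ideal_iff_is_ideal)
  show "?J \<subseteq> ?I"
  proof (rule monomial_span_subset_ideal[OF I])
    fix \<alpha> and c :: 'k assume "\<alpha> \<in> UNIV + G"
    then obtain \<beta> \<gamma> where \<alpha>: "\<alpha> = \<beta> + \<gamma>" "\<gamma> \<in> G" by (auto elim: set_plus_elim)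
    have "Poly_Mapping.single \<gamma> 1 \<in> ?I"
      using genideal_self[of "(\<lambda>\<alpha>. Poly_Mapping.single \<alpha> 1) ` G"] \<alpha>(2) by auto
    then have "Poly_Mapping.single \<beta> c * Poly_Mapping.single \<gamma> 1 \<in> ?I" by (rule is_ideal_mult[OF I])
    then show "Poly_Mapping.single \<alpha> c \<in> ?I" by (simp add: mult_single \<alpha>)
  qed
qed

lemma ideal_prod_monomial_span:
  assumes "up_closed A" "up_closed B"
  shows "ideal_prod mpoly_ring (monomial_span A) (monomial_span B) = (monomial_span (A + B) :: ('v, 'k::field) mpoly set)"
proof
  show "ideal_prod mpoly_ring (monomial_span A) (monomial_span B) \<subseteq> (monomial_span (A + B) :: ('v, 'k) mpoly set)"
  proof
    fix x :: "('v, 'k) mpoly" assume "x \<in> ideal_prod mpoly_ring (monomial_span A) (monomial_span B)"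
    then show "x \<in> monomial_span (A + B)"
    proof (induction rule: ideal_prod.induct)
      case (prod i j)
      then show ?case using keys_mult[of i j] by (fastforce simp: monomial_span_def)
    next
      case (sum x y)
      then show ?case using keys_add[of x y] by (fastforce simp: monomial_span_def)
    qed
  qed
  interpret ring "mpoly_ring :: ('v, 'k) mpoly ring" by (rule ring_from_type_algebra)
  have "is_ideal (ideal_prod mpoly_ring (monomial_span A) (monomial_span B) :: ('v, 'k) mpoly set)"
    using ideal_prod_is_ideal[of "monomial_span A" "monomial_span B"] by (simp add: ideal_iff_is_ideal is_ideal_monomial_span assms)
  then show "(monomial_span (A + B) :: ('v, 'k) mpoly set) \<subseteq> ideal_prod mpoly_ring (monomial_span A) (monomial_span B)"
  proof (rule monomial_span_subset_ideal)
    fix \<alpha> and c :: 'k assume "\<alpha> \<in> A + B"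
    then obtain a b where \<alpha>: "\<alpha> = a + b" "a \<in> A" "b \<in> B" by (rule set_plus_elim)
    have "Poly_Mapping.single a c \<in> monomial_span A" "Poly_Mapping.single b (1 :: 'k) \<in> monomial_span B"
      using \<alpha> by (auto simp: monomial_span_def)
    from ideal_prod.prod[OF this, of mpoly_ring]
    show "Poly_Mapping.single \<alpha> c \<in> ideal_prod mpoly_ring (monomial_span A) (monomial_span B)"
      by (simp add: mult_single \<alpha>)
  qed
qed

lemma edge_ideal_eq:
  "edge_ideal E = (monomial_span (edge_exponents E 1) :: ('v, 'k::field) mpoly set)"
proof -
  define G where "G = {var_exp u + var_exp v | u v. {u, v} \<in> E}"
  have "{indet u * indet v | u v. {u, v} \<in> E} = (\<lambda>\<alpha>. Poly_Mapping.single \<alpha> (1 :: 'k)) ` G"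
    by (force simp: G_def indet_eq mult_single)
  moreover have "UNIV + G = edge_exponents E 1"
    by (auto simp: G_def set_plus_def add.assoc)
  ultimately show ?thesis unfolding edge_ideal_def by (simp add: genideal_monomials)
qed

lemma edge_exponents_Suc: "edge_exponents E (Suc t) = edge_exponents E t + edge_exponents E 1"
proof
  show "edge_exponents E (Suc t) \<subseteq> edge_exponents E t + edge_exponents E 1"
  proof
    fix \<alpha> assume "\<alpha> \<in> edge_exponents E (Suc t)"
    then obtain \<gamma> u v where \<gamma>: "\<alpha> = \<gamma> + (0 + var_exp u + var_exp v)" "\<gamma> \<in> edge_exponents E t" "{u, v} \<in> E"
      by (auto simp: add.assoc)
    then have "0 + var_exp u + var_exp v \<in> edge_exponents E (Suc 0)"
      unfolding edge_exponents.simps by blast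
    with \<gamma> show "\<alpha> \<in> edge_exponents E t + edge_exponents E 1"
      unfolding One_nat_def by blast
  qed
  show "edge_exponents E t + edge_exponents E 1 \<subseteq> edge_exponents E (Suc t)"
  proof
    fix \<alpha> assume "\<alpha> \<in> edge_exponents E t + edge_exponents E 1"
    then obtain \<beta> \<gamma> u v where *: "\<alpha> = \<beta> + (\<gamma> + var_exp u + var_exp v)" "\<beta> \<in> edge_exponents E t" "{u, v} \<in> E"
      by (auto elim!: set_plus_elim)
    moreover from *(2) have "\<beta> + \<gamma> \<in> edge_exponents E t"
      using up_closed_edge_exponents[of E t] by (simp add: up_closed_def)
    ultimately show "\<alpha> \<in> edge_exponents E (Suc t)" by (auto simp flip: add.assoc)
  qed
qed

lemma ideal_power_edge_ideal:
  "ideal_power mpoly_ring (edge_ideal E) t = (monomial_span (edge_exponents E t) :: ('v, 'k::field) mpoly set)"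
proof (induction t)
  case 0
  \<comment> \<open>The unit of \<open>ideals_set\<close> is the whole ring, which matches
    \<open>edge_exponents E 0 = UNIV\<close>.\<close>
  show ?case by (simp add: ideal_power_def nat_pow_def ideals_set_def monomial_span_def)
next
  case (Suc t)
  have "ideal_power mpoly_ring (edge_ideal E) (Suc t) =
    ideal_prod mpoly_ring (monomial_span (edge_exponents E t)) (monomial_span (edge_exponents E 1) :: ('v, 'k) mpoly set)"
    unfolding Suc[symmetric] edge_ideal_eq[symmetric]
    by (simp add: ideal_power_def nat_pow_def ideals_set_def)
  then show ?case by (simp only: ideal_prod_monomial_span up_closed_edge_exponents edge_exponents_Suc[of E t])
qed

lemma max_ideal_eq: "max_ideal = (monomial_span {\<alpha>. \<alpha> \<noteq> 0} :: ('v, 'k::field) mpoly set)"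
proof -
  have "range (indet :: 'v \<Rightarrow> _) = (\<lambda>\<alpha>. Poly_Mapping.single \<alpha> (1 :: 'k)) ` range var_exp"
    by (auto simp: indet_eq)
  moreover have "UNIV + range var_exp = {\<alpha> :: 'v \<Rightarrow>\<^sub>0 nat. \<alpha> \<noteq> 0}"
  proof
    have "\<beta> + var_exp v \<noteq> 0" for \<beta> and v :: 'v
    proof
      assume "\<beta> + var_exp v = 0"
      then have "Poly_Mapping.lookup (\<beta> + var_exp v) v = 0" by simp
      then show False by (simp add: lookup_add)
    qed
    then show "UNIV + range var_exp \<subseteq> {\<alpha> :: 'v \<Rightarrow>\<^sub>0 nat. \<alpha> \<noteq> 0}" by (auto simp: set_plus_def)
    show "{\<alpha> :: 'v \<Rightarrow>\<^sub>0 nat. \<alpha> \<noteq> 0} \<subseteq> UNIV + range var_exp"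
    proof
      fix \<alpha> :: "'v \<Rightarrow>\<^sub>0 nat" assume "\<alpha> \<in> {\<alpha>. \<alpha> \<noteq> 0}"
      then have "Poly_Mapping.keys \<alpha> \<noteq> {}" by simp
      then obtain v where "v \<in> Poly_Mapping.keys \<alpha>" by blast
      then show "\<alpha> \<in> UNIV + range var_exp"
        using set_plus_intro[of "\<alpha> - var_exp v" UNIV "var_exp v" "range var_exp"]
        by (simp add: exponent_split)
    qed
  qed
  ultimately show ?thesis unfolding max_ideal_def by (simp only: genideal_monomials)
qed

theorem proposition4p3:
  fixes E :: "'v::finite set set" and t p :: nat
  defines "R \<equiv> (mpoly_ring :: ('v, 'k::field) mpoly ring)"
  assumes "simple_graph E"
    and "no_isolated_vertices E"
    and "p = card (connected_components E)"
    and "t \<ge> 1"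
  shows "depth R max_ideal (quot_module R (ideal_power R (edge_ideal E) t)) \<ge> enat (p - t)"
proof -
  obtain f :: "'v \<Rightarrow> nat" where "inj f"
    using finite_imp_inj_to_nat_seg[OF finite[of "UNIV :: 'v set"]] by auto
  then interpret ranked_graph E f using assms(2) by unfold_locales
  define J :: "('v, 'k) mpoly set" where "J = monomial_span (edge_exponents E t)"
  \<comment> \<open>For p \<le> t the difference is 0 and the sequence is empty.\<close>
  define \<theta>s :: "('v, 'k) mpoly list" where "\<theta>s = esym_params (p - t)"
  have up: "up_closed {\<alpha> :: 'v \<Rightarrow>\<^sub>0 nat. \<alpha> \<noteq> 0}"
    by (auto simp: up_closed_def poly_mapping_eq_iff fun_eq_iff lookup_add)
  then have max: "is_ideal (max_ideal :: ('v, 'k) mpoly set)"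
    unfolding max_ideal_eq by (rule is_ideal_monomial_span)
  \<comment> \<open>Properness rests on t \<ge> 1, since I^0 is the whole ring.\<close>
  have "edge_exponents E t \<subseteq> {\<alpha>. \<alpha> \<noteq> 0}"
    using \<open>t \<ge> 1\<close> by (cases t) (auto dest!: arg_cong[of _ 0 Poly_Mapping.keys] simp: keys_add_exp)
  then have J_max: "J \<subseteq> max_ideal" unfolding J_def max_ideal_eq by (rule monomial_span_mono)
  have \<theta>s_max: "set \<theta>s \<subseteq> max_ideal"
  proof
    fix \<theta> assume "\<theta> \<in> set \<theta>s"
    then obtain e where "e > 0" "homogeneous e \<theta>" unfolding \<theta>s_def using homogeneous_esym_params by blast
    then show "\<theta> \<in> max_ideal"
      by (auto simp: max_ideal_eq monomial_span_def homogeneous_def total_degree_def)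
  qed
  have "ideal_extend \<theta>s J \<subseteq> max_ideal"
  proof (intro ideal_extend_minimal max J_max)
    fix \<theta> x assume "\<theta> \<in> set \<theta>s"
    then have "x * \<theta> \<in> max_ideal" using \<theta>s_max by (intro is_ideal_mult[OF max]) auto
    then show "\<theta> * x \<in> max_ideal" by (simp only: mult.commute)
  qed
  moreover have "1 \<notin> (max_ideal :: ('v, 'k) mpoly set)"
    by (simp add: max_ideal_eq monomial_span_def)
  ultimately have "1 \<notin> ideal_extend \<theta>s J" by blast
  moreover have "weakly_regular \<theta>s UNIV J"
    unfolding \<theta>s_def J_def assms(4) by (rule weakly_regular_edge_exponents)
  moreover have "is_ideal J"
    unfolding J_def by (intro is_ideal_monomial_span up_closed_edge_exponents)
  ultimately have "regular_sequence R (quot_module R J) \<theta>s"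
    unfolding R_def by (intro regular_sequence_quot_module)
  then have "enat (length \<theta>s) \<le> depth R max_ideal (quot_module R J)"
    unfolding depth_def using \<theta>s_max by (intro SUP_upper) simp
  moreover have "length \<theta>s = p - t" by (simp add: \<theta>s_def esym_params_def del: upt_Suc)
  ultimately show ?thesis by (simp add: R_def ideal_power_edge_ideal J_def)
qed

end
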